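(* There exists no $\rho$-competitive online exploration algorithm with $\rho<\frac{5+3\sqrt{17}}{8}\approx 2.17$ for the collaborative tree exploration problem with energy-bounded agents.
   Context: An instance is $I=\langle T,r,k,B\rangle$: $T$ is a finite undirected tree, initially unknown, rooted at $r$; $k$ agents start at $r$; each agent can traverse at most $B$ edges in total. At every vertex $v$ the incident edges carry locally distinct labels (port numbers) $0,\dots,\delta_v-1$ ($\delta_v$ the degree of $v$). When an agent arrives at a new vertex it learns the port number of the arrival edge and the degree of the vertex; all information (map of the explored part, agent positions) is instantly shared among all agents. The goal is to maximize the number of distinct vertices visited. For an online algorithm $\textsc{Alg}$, $|\textsc{Alg}(I)|$ is the number of distinct vertices it visits, and $|\textsc{Opt}(I)|$ is the maximum number of distinct vertices that $k$ agents with budget $B$ starting at $r$ can visit when $T$ is known in advance. $\textsc{Alg}$ is $\rho$-competitive if $\sup_I |\textsc{Opt}(I)|/|\textsc{Alg}(I)|\le\rho$. *)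

theory Defs
  imports
    "Graph_Theory.Pair_Digraph"
    "Graph_Theory.Digraph_Component"
    "Graph_Theory.Vertex_Walk"
    "HOL-Library.Extended_Real"
begin

text \<open>
  A finite simple undirected graph is a \<open>pair_graph\<close>: every edge is represented by its two opposite
  arcs. A closed walk \<open>u, v, u\<close> along a single edge counts as a \<open>cycle\<close> of this symmetric digraph,
  so the library's \<open>forest\<close> and \<open>tree\<close> are unsuitable for undirected graphs. The cycles of the
  undirected graph are the ones of length at least 3. The predicate \<open>connected\<close> includes that there
  is at least one vertex.
\<close>
definition undirected_tree :: "'v pair_pre_digraph \<Rightarrow> bool" where
  "undirected_tree G \<longleftrightarrow>
     pair_graph G \<and>
     Digraph_Component.connected (with_proj G) \<and>
     \<not> (\<exists>p. pre_digraph.cycle (with_proj G) p \<and> length p \<ge> 3)"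

text \<open>
  \<open>iport I (u, v)\<close> is the port number of the edge \<open>{u, v}\<close> at its endpoint \<open>u\<close>. Taking natural numbers
  as vertices is no restriction for finite trees: algorithms never see the vertex names.
\<close>
record explore_inst =
  itree :: "nat pair_pre_digraph"
  iroot :: nat
  iport :: "nat \<times> nat \<Rightarrow> nat"
  iagents :: nat
  ibudget :: nat

definition idegree :: "explore_inst \<Rightarrow> nat \<Rightarrow> nat" where
  "idegree I v = out_degree (with_proj (itree I)) v"

definition valid_inst :: "explore_inst \<Rightarrow> bool" where
  "valid_inst I \<longleftrightarrow>
     undirected_tree (itree I) \<and>
     iroot I \<in> pverts (itree I) \<and>
     (\<forall>v \<in> pverts (itree I).
        bij_betw (iport I) (out_arcs (with_proj (itree I)) v) {..<idegree I v}) \<and>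
     iagents I \<ge> 1"

text \<open>
  What is learnt from one edge traversal: the agent that moved, the port by which it left, the port
  by which it arrived and the degree of the vertex reached. In a tree, the degree of the root together
  with the list of all observations so far determines the map of the explored part (with all port
  numbers and vertex degrees) and the positions of all agents.
\<close>
datatype observation =
  Obs (obs_agent: nat) (obs_exit: nat) (obs_entry: nat) (obs_degree: nat)

text \<open>
  An online algorithm is a function of the number of agents, the budget, the degree of the root and
  the observations made so far, in chronological order. Its decision is either to let agent \<open>a\<close> leave
  its current vertex by port \<open>p\<close>, given as \<open>Some (a, p)\<close>, or to stop, given as \<open>None\<close>. Agents move one
  at a time. As there is no time limit, this also covers simultaneous moves: they can be carried out
  one after the other.
\<close>
type_synonym online_algorithm = "nat \<Rightarrow> nat \<Rightarrow> nat \<Rightarrow> observation list \<Rightarrow> (nat \<times> nat) option"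

record config =
  cpos :: "nat \<Rightarrow> nat"
  cused :: "nat \<Rightarrow> nat"
  cvisited :: "nat set"
  chist :: "observation list"

definition init_config :: "explore_inst \<Rightarrow> config" where
  "init_config I =
     \<lparr> cpos = (\<lambda>_. iroot I), cused = (\<lambda>_. 0), cvisited = {iroot I}, chist = [] \<rparr>"

definition port_target :: "explore_inst \<Rightarrow> nat \<Rightarrow> nat \<Rightarrow> nat" where
  "port_target I u p = (THE v. (u, v) \<in> parcs (itree I) \<and> iport I (u, v) = p)"

definition legal_move :: "explore_inst \<Rightarrow> config \<Rightarrow> nat \<Rightarrow> nat \<Rightarrow> bool" where
  "legal_move I c a p \<longleftrightarrow> a < iagents I \<and> p < idegree I (cpos c a) \<and> cused c a < ibudget I"

definition do_move :: "explore_inst \<Rightarrow> config \<Rightarrow> nat \<Rightarrow> nat \<Rightarrow> config" where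
  "do_move I c a p =
     (let u = cpos c a; v = port_target I u p in
      \<lparr> cpos = (cpos c)(a := v),
        cused = (cused c)(a := cused c a + 1),
        cvisited = insert v (cvisited c),
        chist = chist c @ [Obs a p (iport I (v, u)) (idegree I v)] \<rparr>)"

text \<open>
  A decision that is not a legal move leaves the configuration, and hence all later decisions,
  unchanged: it has the same effect as stopping.
\<close>
definition alg_step :: "online_algorithm \<Rightarrow> explore_inst \<Rightarrow> config \<Rightarrow> config" where
  "alg_step A I c =
     (case A (iagents I) (ibudget I) (idegree I (iroot I)) (chist c) of
        None \<Rightarrow> c
      | Some (a, p) \<Rightarrow> if legal_move I c a p then do_move I c a p else c)"

definition alg_config :: "online_algorithm \<Rightarrow> explore_inst \<Rightarrow> nat \<Rightarrow> config" where
  "alg_config A I n = (alg_step A I ^^ n) (init_config I)"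

definition alg_value :: "online_algorithm \<Rightarrow> explore_inst \<Rightarrow> nat" where
  "alg_value A I = card (\<Union>n. cvisited (alg_config A I n))"

definition offline_strategy :: "explore_inst \<Rightarrow> (nat \<Rightarrow> nat list) \<Rightarrow> bool" where
  "offline_strategy I w \<longleftrightarrow>
     (\<forall>a < iagents I. vwalk (w a) (with_proj (itree I)) \<and> hd (w a) = iroot I \<and>
                      vwalk_length (w a) \<le> ibudget I)"

definition opt_value :: "explore_inst \<Rightarrow> nat" where
  "opt_value I = Max {card (\<Union>a < iagents I. set (w a)) | w. offline_strategy I w}"

definition competitive :: "real \<Rightarrow> online_algorithm \<Rightarrow> bool" where
  "competitive \<rho> A \<longleftrightarrow>
     (SUP I \<in> {I. valid_inst I}. ereal (real (opt_value I) / real (alg_value A I))) \<le> ereal \<rho>"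

end

theory Submission
  imports Defs "HOL-Library.Countable" "HOL-Real_Asymp.Real_Asymp"
begin

text \<open>
  An adversary lets \<open>k = 2 m\<close> agents explore a root with \<open>m\<close> legs of length \<open>s\<close>, about \<open>0.255 B\<close>.
  The end of a leg has so many children, \<open>N\<close>, that the agents can never walk \<open>\<sigma>\<close> steps into all
  of them. The first agent that reaches the end of a leg owns the leg. A branch whose vertices are
  discovered by the owner goes on as a path down to depth \<open>T\<close>, about \<open>(B - s) / 2\<close>, where it splits
  into \<open>N\<close> children again. A branch in which another agent takes the lead ends at depth \<open>s + \<sigma>\<close>, or
  at once if a second agent has flagged the leg; the last leg is never flagged. Likewise the
  branches below a vertex at depth \<open>T\<close> end at once after a non-owner confined to the leg has arrived
  there: that agent cannot afford a second leg any more. So an owner finds at most about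
  \<open>(B + T) / 2 - s\<close> vertices below the ends of the legs, and almost every other agent about
  \<open>(B - 3 s) / 2\<close>, which it achieves only by visiting two legs.

  When the algorithm has stopped, every unused port leads to \<open>k\<close> long paths. An agent that walks
  straight to an unused port in its own leg visits \<open>B\<close> vertices, and all other agents use the
  unflagged leg, where each finds \<open>B - s\<close> vertices of its own. If a leg is dead, that is, without an unused
  port, the optimum loses \<open>s\<close>, but somebody had to retrace the paths of the owner to close the leg,
  and so the algorithm loses \<open>(B - 3 s) / 2\<close>. With \<open>s = (19 - 3 sqrt 17) / 26 * B\<close> the ratio of these
  losses is the claimed constant, which is also the limit of the ratio of the values for \<open>m\<close> to
  infinity.
\<close>

section \<open>Trees given by numbers of children\<close>

text \<open>A vertex is addressed by the list of ports on the way down from the root, and \<open>ch\<close> gives the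
  numbers of children. The ports \<open>0, \<dots>, ch v - 1\<close> of \<open>v\<close> lead to the children, the port \<open>ch v\<close> to the
  parent.\<close>
definition addresses :: "(nat list \<Rightarrow> nat) \<Rightarrow> nat list set" where
  "addresses ch = {v. \<forall>j < length v. v ! j < ch (take j v)}"

lemma Nil_in_addresses [simp]: "[] \<in> addresses ch"
  by (simp add: addresses_def)

lemma snoc_in_addresses [simp]:
  "v @ [j] \<in> addresses ch \<longleftrightarrow> v \<in> addresses ch \<and> j < ch v"
  by (auto simp: addresses_def nth_append less_Suc_eq)

lemma singleton_in_addresses [simp]: "[j] \<in> addresses ch \<longleftrightarrow> j < ch []"
  using snoc_in_addresses[of "[]" j ch] by simp

lemma addresses_butlast: "v \<in> addresses ch \<Longrightarrow> butlast v \<in> addresses ch"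
  by (cases v rule: rev_cases) auto

definition adjacent :: "nat list \<Rightarrow> nat list \<Rightarrow> bool" where
  "adjacent v w \<longleftrightarrow> (w \<noteq> [] \<and> butlast w = v) \<or> (v \<noteq> [] \<and> butlast v = w)"

lemma adjacent_sym: "adjacent v w \<longleftrightarrow> adjacent w v"
  by (auto simp: adjacent_def)

text \<open>Vertices are encoded by \<open>to_nat\<close>, as instances live on natural numbers. Of
  the endpoints of an edge the deeper one has the longer address, which decides whether a port leads
  to a child or to the parent.\<close>

definition tree_inst :: "(nat list \<Rightarrow> nat) \<Rightarrow> nat \<Rightarrow> nat \<Rightarrow> explore_inst" where
  "tree_inst ch k B =
     \<lparr> itree = \<lparr> pverts = to_nat ` addresses ch,
                 parcs = {(to_nat v, to_nat w) | v w.
                           v \<in> addresses ch \<and> w \<in> addresses ch \<and> adjacent v w} \<rparr>,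
       iroot = to_nat ([] :: nat list),
       iport = (\<lambda>(x, y). let v = from_nat x :: nat list; w = from_nat y
                         in if length v < length w then last w else ch v),
       iagents = k, ibudget = B \<rparr>"

definition deg :: "(nat list \<Rightarrow> nat) \<Rightarrow> nat list \<Rightarrow> nat" where
  "deg ch v = ch v + (if v = [] then 0 else 1)"

definition nbr :: "(nat list \<Rightarrow> nat) \<Rightarrow> nat list \<Rightarrow> nat \<Rightarrow> nat list" where
  "nbr ch v p = (if p < ch v then v @ [p] else butlast v)"

lemma tree_inst_simps [simp]:
  "iroot (tree_inst ch k B) = to_nat ([] :: nat list)"
  "iagents (tree_inst ch k B) = k"
  "ibudget (tree_inst ch k B) = B"
  "pverts (itree (tree_inst ch k B)) = to_nat ` addresses ch"
  by (simp_all add: tree_inst_def)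

lemma arc_iff [simp]:
  "(to_nat v, to_nat w) \<in> parcs (itree (tree_inst ch k B)) \<longleftrightarrow>
     v \<in> addresses ch \<and> w \<in> addresses ch \<and> adjacent v w" for v w :: "nat list"
  by (auto simp: tree_inst_def)

lemma iport_tree_inst [simp]:
  "iport (tree_inst ch k B) (to_nat v, to_nat w) =
     (if length v < length w then last w else ch v)" for v w :: "nat list"
  by (simp add: tree_inst_def)

lemma neighbours:
  assumes "v \<in> addresses ch"
  shows "{w \<in> addresses ch. adjacent v w} = nbr ch v ` {..<deg ch v}"
proof (intro set_eqI iffI)
  fix w assume "w \<in> {w \<in> addresses ch. adjacent v w}"
  then have w: "w \<in> addresses ch" and "adjacent v w" by auto
  then consider (child) "w \<noteq> []" "butlast w = v" | (parent) "v \<noteq> []" "butlast v = w"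
    unfolding adjacent_def by blast
  then show "w \<in> nbr ch v ` {..<deg ch v}"
  proof cases
    case child
    then obtain j where "w = v @ [j]" by (metis append_butlast_last_id)
    with w have "j < ch v" by simp
    with \<open>w = v @ [j]\<close> show ?thesis by (auto simp: nbr_def deg_def intro!: image_eqI[of _ _ j])
  next
    case parent
    then show ?thesis by (auto simp: nbr_def deg_def intro!: image_eqI[of _ _ "ch v"])
  qed
next
  fix w assume "w \<in> nbr ch v ` {..<deg ch v}"
  then show "w \<in> {w \<in> addresses ch. adjacent v w}"
    using assms addresses_butlast[OF assms]
    by (auto simp: nbr_def deg_def adjacent_def split: if_splits)
qed

lemma nbr_in_addresses:
  assumes "v \<in> addresses ch" "p < deg ch v"
  shows "nbr ch v p \<in> addresses ch" "adjacent v (nbr ch v p)"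
  using neighbours[OF assms(1)] assms(2) by blast+

lemma iport_nbr:
  assumes "p < deg ch v"
  shows "iport (tree_inst ch k B) (to_nat v, to_nat (nbr ch v p)) = p"
proof (cases "p < ch v")
  case True then show ?thesis by (simp add: nbr_def)
next
  case False
  with assms have "v \<noteq> []" "p = ch v" by (auto simp: deg_def split: if_splits)
  then show ?thesis by (auto simp: nbr_def)
qed

lemma out_arcs_tree_inst:
  assumes "v \<in> addresses ch"
  shows "out_arcs (with_proj (itree (tree_inst ch k B))) (to_nat v) =
           (\<lambda>p. (to_nat v, to_nat (nbr ch v p))) ` {..<deg ch v}"
proof -
  have "out_arcs (with_proj (itree (tree_inst ch k B))) (to_nat v) =
          (\<lambda>w. (to_nat v, to_nat w)) ` {w \<in> addresses ch. adjacent v w}"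
    using assms by (auto simp: out_arcs_def tree_inst_def)
  then show ?thesis by (simp add: neighbours[OF assms] image_image)
qed

lemma inj_nbr: "inj_on (\<lambda>p. (to_nat v, to_nat (nbr ch v p))) {..<deg ch v}" for v :: "nat list"
  \<comment> \<open>The port function is a left inverse; ports do not depend on the number of agents
    and the budget, so zeros will do.\<close>
  by (rule inj_on_inverseI[of _ "iport (tree_inst ch 0 0)"]) (simp add: iport_nbr del: iport_tree_inst)

lemma idegree_tree_inst:
  assumes "v \<in> addresses ch"
  shows "idegree (tree_inst ch k B) (to_nat v) = deg ch v"
  unfolding idegree_def out_degree_def out_arcs_tree_inst[OF assms]
  by (simp add: card_image[OF inj_nbr])

lemma port_target_tree_inst:
  assumes "v \<in> addresses ch" "p < deg ch v"
  shows "port_target (tree_inst ch k B) (to_nat v) p = to_nat (nbr ch v p)"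
  unfolding port_target_def
proof (rule the_equality)
  show "(to_nat v, to_nat (nbr ch v p)) \<in> parcs (itree (tree_inst ch k B)) \<and>
        iport (tree_inst ch k B) (to_nat v, to_nat (nbr ch v p)) = p"
    using nbr_in_addresses[OF assms] assms iport_nbr[OF assms(2)]
    by (simp del: iport_tree_inst)
next
  fix y assume y: "(to_nat v, y) \<in> parcs (itree (tree_inst ch k B)) \<and>
    iport (tree_inst ch k B) (to_nat v, y) = p"
  then obtain w where w: "y = to_nat w" "w \<in> addresses ch" "adjacent v w"
    by (auto simp: tree_inst_def)
  then obtain q where "q < deg ch v" "w = nbr ch v q"
    using neighbours[OF assms(1)] by blast
  then show "y = to_nat (nbr ch v p)"
    using y w iport_nbr[of q ch v k B] by (simp del: iport_tree_inst)
qed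

section \<open>Acyclicity and connectedness of these trees\<close>

lemma pcas_nth:
  assumes "pcas u p v"
  shows "p \<noteq> [] \<Longrightarrow> fst (p ! 0) = u" "p \<noteq> [] \<Longrightarrow> snd (p ! (length p - 1)) = v"
    "\<And>i. Suc i < length p \<Longrightarrow> fst (p ! Suc i) = snd (p ! i)"
proof -
  have "(p \<noteq> [] \<longrightarrow> fst (p ! 0) = u \<and> snd (p ! (length p - 1)) = v) \<and>
        (\<forall>i. Suc i < length p \<longrightarrow> fst (p ! Suc i) = snd (p ! i))"
    using assms
  proof (induction u p v rule: pcas.induct)
    case (2 u e es v)
    then show ?case
      by (cases es) (auto simp: nth_Cons split: nat.splits)
  qed simp
  then show "p \<noteq> [] \<Longrightarrow> fst (p ! 0) = u" "p \<noteq> [] \<Longrightarrow> snd (p ! (length p - 1)) = v"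
    "\<And>i. Suc i < length p \<Longrightarrow> fst (p ! Suc i) = snd (p ! i)" by auto
qed

lemma pawalk_verts_pcas: "pcas u p v \<Longrightarrow> pawalk_verts u p = u # map snd p"
  by (induction u p v rule: pcas.induct) auto

text \<open>A deepest vertex of a cycle has the same neighbour, its parent, on both sides.\<close>
lemma no_cycle_tree_inst:
  assumes "pre_digraph.cycle (with_proj (itree (tree_inst ch k B))) p"
  shows "length p < 3"
proof (rule ccontr)
  assume "\<not> length p < 3"
  define n where "n = length p"
  have n: "n \<ge> 3" using \<open>\<not> length p < 3\<close> n_def by simp
  from assms obtain u where
    arcs: "set p \<subseteq> parcs (itree (tree_inst ch k B))" and cas: "pcas u p u" and
    dist: "distinct (tl (pawalk_verts u p))"
    by (auto simp: pre_digraph.cycle_def pre_digraph.awalk_def cas_with_proj_eq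
        awalk_verts_with_proj_eq)
  have "distinct (map snd p)" using dist by (simp add: pawalk_verts_pcas[OF cas])
  have ne: "p \<noteq> []" using n n_def by auto
  define g where "g i = (from_nat (snd (p ! i)) :: nat list)" for i
  \<comment> \<open>Indices are read cyclically: arc \<open>i\<close> starts at the head of arc
    \<open>pr i\<close>, also for \<open>i = 0\<close>, because the walk is closed.\<close>
  define pr where "pr i = (if i = 0 then n - 1 else i - 1)" for i
  define su where "su i = (if i = n - 1 then 0 else Suc i)" for i
  have fst_p: "fst (p ! i) = snd (p ! pr i)" if "i < n" for i
    using pcas_nth[OF cas] ne that by (cases i) (auto simp: pr_def n_def)
  have arc: "adjacent (g (pr i)) (g i)" "snd (p ! i) = to_nat (g i)" if "i < n" for i
  proof -
    have "p ! i \<in> parcs (itree (tree_inst ch k B))" using arcs that n_def by auto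
    then obtain v w where vw: "p ! i = (to_nat v, to_nat w)" "adjacent v w"
      by (auto simp: tree_inst_def)
    moreover from fst_p[OF that] vw(1) have "to_nat v = snd (p ! pr i)" by simp
    then have "g (pr i) = v" unfolding g_def by (metis from_nat_to_nat)
    ultimately show "adjacent (g (pr i)) (g i)" "snd (p ! i) = to_nat (g i)"
      by (auto simp: g_def)
  qed
  have inj: "i = j" if "i < n" "j < n" "g i = g j" for i j
    using \<open>distinct (map snd p)\<close> that arc(2)[of i] arc(2)[of j]
    by (simp add: distinct_conv_nth n_def) metis
  define M where "M = Max ((\<lambda>i. length (g i)) ` {..<n})"
  have "g 0 \<in> g ` {..<n}" using n by auto
  then have "M \<in> (\<lambda>i. length (g i)) ` {..<n}"
    unfolding M_def by (intro Max_in) auto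
  then obtain i where i: "i < n" "length (g i) = M" by auto
  have le: "length (g j) \<le> length (g i)" if "j < n" for j
    unfolding i(2) M_def using that by (intro Max_ge) auto
  have pri: "pr i < n" "su i < n" "pr (su i) = i" using i n by (auto simp: pr_def su_def)
  have par: "w = butlast (g i)" if "adjacent w (g i)" "length w \<le> length (g i)" for w
    using that unfolding adjacent_def
    by (metis One_nat_def Suc_pred length_butlast length_greater_0_conv not_less_eq_eq order_refl)
  have "g (pr i) = butlast (g i)" using par arc(1)[OF i(1)] le[OF pri(1)] by blast
  moreover have "g (su i) = butlast (g i)"
    using par arc(1)[OF pri(2)] le[OF pri(2)] pri(3) adjacent_sym by metis
  ultimately have "pr i = su i" using inj pri by metis
  then show False using n i by (auto simp: pr_def su_def split: if_splits)
qed

lemma valid_tree_inst: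
  assumes fin: "finite (addresses ch)" and "k \<ge> 1"
  shows "valid_inst (tree_inst ch k B)"
proof -
  let ?G = "itree (tree_inst ch k B)"
  have sub: "parcs ?G \<subseteq> (\<lambda>(v, w). (to_nat v, to_nat w)) ` (addresses ch \<times> addresses ch)"
    by (auto simp: tree_inst_def)
  have graph: "pair_graph ?G"
  proof unfold_locales
    show "finite (pverts ?G)" using fin by simp
    show "finite (parcs ?G)" using sub fin by (meson finite_SigmaI finite_imageI finite_subset)
    show "symmetric (with_proj ?G)"
      by (auto simp: symmetric_conv tree_inst_def adjacent_sym) 
    fix e assume "e \<in> parcs ?G"
    then obtain v w where e: "e = (to_nat v, to_nat w)" "v \<in> addresses ch" "w \<in> addresses ch"
      "adjacent v w" by (auto simp: tree_inst_def)
    show "fst e \<in> pverts ?G" "snd e \<in> pverts ?G" using e by auto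
    have "v \<noteq> w"
    proof
      assume "v = w"
      with e(4) show False by (cases v rule: rev_cases) (auto simp: adjacent_def)
    qed
    then show "fst e \<noteq> snd e" using e by simp
  qed
  interpret pair_graph ?G by (rule graph)
  \<comment> \<open>\<open>connected\<close> means strong connectedness of the symmetric closure;
    the arcs are symmetric already, so the closure adds none.\<close>
  let ?S = "with_proj (mk_symmetric (with_proj ?G))"
  have S: "parcs (mk_symmetric (with_proj ?G)) = parcs ?G"
    by (auto simp: mk_symmetric_def tree_inst_def adjacent_sym)
  interpret S: wf_digraph ?S
    using wellformed_mk_symmetric wf_digraph_wp_iff by blast
  have reach: "to_nat v \<rightarrow>\<^sup>*\<^bsub>?S\<^esub> to_nat ([] :: nat list) \<and>
               to_nat ([] :: nat list) \<rightarrow>\<^sup>*\<^bsub>?S\<^esub> to_nat v"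
    if "v \<in> addresses ch" for v
    using that
  proof (induction v rule: rev_induct)
    case Nil
    then show ?case by (auto simp: reachable_def)
  next
    case (snoc x xs)
    then have "adjacent xs (xs @ [x])" "adjacent (xs @ [x]) xs"
      by (auto simp: adjacent_def)
    then have "to_nat (xs @ [x]) \<rightarrow>\<^bsub>?S\<^esub> to_nat xs" "to_nat xs \<rightarrow>\<^bsub>?S\<^esub> to_nat (xs @ [x])"
      using snoc.prems by (auto simp: S)
    then show ?case using snoc by (meson S.reachable_adj_trans S.adj_reachable_trans snoc_in_addresses)
  qed
  have conn: "Digraph_Component.connected (with_proj ?G)"
    unfolding Digraph_Component.connected_def
  proof (rule strongly_connectedI)
    show "verts ?S \<noteq> {}"
      using Nil_in_addresses[of ch] by (auto simp del: Nil_in_addresses)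
    fix u v assume "u \<in> verts ?S" "v \<in> verts ?S"
    then obtain x y where "u = to_nat x" "x \<in> addresses ch" "v = to_nat y" "y \<in> addresses ch"
      by auto
    then show "u \<rightarrow>\<^sup>*\<^bsub>?S\<^esub> v" using reach by (meson S.reachable_trans)
  qed
  have "bij_betw (iport (tree_inst ch k B)) (out_arcs (with_proj ?G) x)
          {..<idegree (tree_inst ch k B) x}" if "x \<in> pverts ?G" for x
  proof -
    from that obtain v where v: "x = to_nat v" "v \<in> addresses ch" by auto
    have "bij_betw (iport (tree_inst ch k B))
       ((\<lambda>p. (to_nat v, to_nat (nbr ch v p))) ` {..<deg ch v}) {..<deg ch v}"
      by (rule bij_betwI[where g = "\<lambda>p. (to_nat v, to_nat (nbr ch v p))"])
         (auto simp: iport_nbr simp del: iport_tree_inst)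
    then show ?thesis
      by (simp add: v out_arcs_tree_inst[OF v(2)] idegree_tree_inst[OF v(2)])
  qed
  moreover have "undirected_tree ?G"
    unfolding undirected_tree_def using graph conn no_cycle_tree_inst by (metis not_less)
  ultimately show ?thesis
    unfolding valid_inst_def using assms(2) by auto
qed

section \<open>Offline agents that walk straight down\<close>

lemma downward_walk:
  assumes "p \<in> addresses ch"
  shows "vwalk (map (\<lambda>j. to_nat (take j p)) [0..<Suc (length p)])
           (with_proj (itree (tree_inst ch k B)))"
  using assms
proof (induction p rule: rev_induct)
  case Nil
  then show ?case by (auto simp: vwalk_def)
next
  case (snoc x xs)
  let ?w = "\<lambda>p. map (\<lambda>j. to_nat (take j p)) [0..<Suc (length p)]"
  have eq: "?w (xs @ [x]) = ?w xs @ [to_nat (xs @ [x])]" by simp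
  have arcs_snoc: "vwalk_arcs (ys @ [y, z]) = vwalk_arcs (ys @ [y]) @ [(y, z)]"
    for ys and y z :: nat
    by (induction ys rule: vwalk_arcs.induct) auto
  have "?w xs = map (\<lambda>j. to_nat (take j xs)) [0..<length xs] @ [to_nat xs]" by simp
  then have "vwalk_arcs (?w xs @ [to_nat (xs @ [x])]) =
      vwalk_arcs (?w xs) @ [(to_nat xs, to_nat (xs @ [x]))]"
    using arcs_snoc by (metis append.assoc append_Cons append_Nil)
  moreover have "adjacent xs (xs @ [x])" by (simp add: adjacent_def)
  ultimately show ?case
    using snoc unfolding eq vwalk_def by auto
qed

lemma opt_value_tree_inst_ge:
  assumes fin: "finite (addresses ch)"
    and pth: "\<And>a. a < k \<Longrightarrow> pth a \<in> addresses ch \<and> length (pth a) \<le> B"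
  shows "card (\<Union>a<k. (\<lambda>j. take j (pth a)) ` {..length (pth a)}) \<le> opt_value (tree_inst ch k B)"
proof -
  let ?I = "tree_inst ch k B"
  define w where "w a = map (\<lambda>j. to_nat (take j (pth a))) [0..<Suc (length (pth a))]" for a
  have "offline_strategy ?I w"
    unfolding offline_strategy_def
  proof (intro allI impI)
    fix a assume "a < iagents ?I"
    then show "vwalk (w a) (with_proj (itree ?I)) \<and> hd (w a) = iroot ?I \<and>
      vwalk_length (w a) \<le> ibudget ?I"
      using downward_walk[of "pth a"] pth[of a] by (auto simp: w_def hd_map simp del: upt_Suc)
  qed
  \<comment> \<open>Finiteness is what makes the \<open>Max\<close> in \<open>opt_value\<close> an
    upper bound.\<close>
  moreover have "finite {card (\<Union>a < iagents ?I. set (w a)) | w. offline_strategy ?I w}"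
  proof (rule finite_subset)
    show "{card (\<Union>a < iagents ?I. set (w a)) | w. offline_strategy ?I w}
            \<subseteq> {..card (to_nat ` addresses ch)}"
      using fin by (auto simp: offline_strategy_def vwalk_def intro!: card_mono)
  qed simp
  ultimately have "card (\<Union>a < iagents ?I. set (w a)) \<le> opt_value ?I"
    unfolding opt_value_def by (intro Max_ge) auto
  moreover have "(\<Union>a < iagents ?I. set (w a)) =
      to_nat ` (\<Union>a<k. (\<lambda>j. take j (pth a)) ` {..length (pth a)})"
    by (auto simp: w_def image_UN image_image atLeast0LessThan lessThan_Suc_atMost simp del: upt_Suc)
  ultimately show ?thesis by (simp add: card_image inj_on_subset[OF inj_to_nat subset_UNIV])
qed

section \<open>The adversary\<close>

text \<open>Beyond the usual data, a state of the game records for every vertex the number of children that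
  the adversary has fixed (\<open>gch\<close>) and the discoverer (\<open>gdisc\<close>), for every agent the first leg whose
  end it has reached (\<open>gell\<close>), for every leg its owner (\<open>gown\<close>), the flagged legs (\<open>gfl\<close>), and the
  closed vertices at depth \<open>T\<close> (\<open>gtf\<close>). The leg of \<open>v\<close> is \<open>hd v\<close>. The values of \<open>gch\<close> and \<open>gdisc\<close> are
  meaningful only on \<open>gall\<close>.\<close>
record game =
  gpos :: "nat \<Rightarrow> nat list"
  gused :: "nat \<Rightarrow> nat"
  gvis :: "nat \<Rightarrow> nat list set"
  gall :: "nat list set"
  gch :: "nat list \<Rightarrow> nat"
  gdisc :: "nat list \<Rightarrow> nat"
  gell :: "nat \<Rightarrow> nat option"
  gown :: "nat \<Rightarrow> nat option"
  gfl :: "nat set"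
  gtf :: "nat list set"
  ghist :: "observation list"

text \<open>\<open>B_le\<close> excludes a second leg: after a trip to depth \<open>T\<close> and
  back to the root at most \<open>s\<close> edges remain, enough to reach the end of another leg but
  not to pass it. \<open>N\<close> branches of length \<open>\<sigma>\<close> will exceed what all
  agents together can explore.\<close>

locale adversary =
  fixes m k s T \<sigma> N B :: nat
  assumes m_pos: "1 \<le> m" and s_pos: "1 \<le> s" and \<sigma>_pos: "1 \<le> \<sigma>" and T_large: "s + \<sigma> < T"
    and B_le: "B \<le> 2 * T + s" and N_pos: "1 \<le> N"
begin

definition new_ch :: "game \<Rightarrow> nat \<Rightarrow> nat list \<Rightarrow> nat" where
  "new_ch st a v =
     (if length v < s then 1
      else if length v = s then N
      else if length v \<le> T then
        (if gown st (hd v) = Some a then (if length v = T then N else 1)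
         else if hd v \<in> gfl st \<or> s + \<sigma> \<le> length v then 0 else 1)
      else if take T v \<in> gtf st \<or> T + \<sigma> \<le> length v then 0 else 1)"

text \<open>The agent may still walk along other legs as far as their ends; it must never have been
  below them.\<close>

definition confined :: "game \<Rightarrow> nat \<Rightarrow> nat \<Rightarrow> bool" where
  "confined st a i \<longleftrightarrow> (\<forall>x \<in> gvis st a. s < length x \<longrightarrow> hd x = i)"

text \<open>The number of children of a new vertex is fixed on discovery, since its degree must be
  reported at once. Going down, an agent arrives by the parent port, whose number is the number of
  children; going up, it arrives by the port that leads down to \<open>u\<close>, the last entry of
  \<open>u\<close>. A leg is flagged only while another one stays unflagged.\<close>

definition move :: "game \<Rightarrow> nat \<Rightarrow> nat \<Rightarrow> game" where
  "move st a p =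
     (let u = gpos st a; v = nbr (gch st) u p;
          ch = (if v \<in> gall st then gch st else (gch st)(v := new_ch st a v));
          first = (length v = s \<and> gell st a = None)
      in st\<lparr> gpos := (gpos st)(a := v),
             gused := (gused st)(a := gused st a + 1),
             gvis := (gvis st)(a := insert v (gvis st a)),
             gall := insert v (gall st),
             gch := ch,
             gdisc := (if v \<in> gall st then gdisc st else (gdisc st)(v := a)),
             gell := (if first then (gell st)(a := Some (hd v)) else gell st),
             gown := (if first \<and> gown st (hd v) = None then (gown st)(hd v := Some a) else gown st),
             gfl := (if first \<and> gown st (hd v) \<noteq> None \<and> (\<exists>j<m. j \<noteq> hd v \<and> j \<notin> gfl st)
                     then insert (hd v) (gfl st) else gfl st),
             gtf := (if length v = T \<and> v \<in> gall st \<and> gch st v \<noteq> 0 \<and> gell st a = Some (hd v) \<and>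
                        gown st (hd v) \<noteq> Some a \<and> confined st a (hd v)
                     then insert v (gtf st) else gtf st),
             ghist := ghist st @ [Obs a p (if length u < length v then ch v else last u) (deg ch v)] \<rparr>)"

definition start :: game where
  "start = \<lparr> gpos = (\<lambda>_. []), gused = (\<lambda>_. 0), gvis = (\<lambda>_. {[]}), gall = {[]},
             gch = (\<lambda>_. m), gdisc = (\<lambda>_. 0), gell = (\<lambda>_. None), gown = (\<lambda>_. None),
             gfl = {}, gtf = {}, ghist = [] \<rparr>"

end

text \<open>In \<open>cost\<close>, an agent has crossed every edge of its visited subtree twice, except for those on the
  way to its position. A member of \<open>gtf\<close> has a witness that has already spent \<open>2 T\<close>, up to the
  distance of its position from the root, and so cannot pass depth \<open>s\<close> in another leg (\<open>tf_ex\<close>).\<close>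
locale game_inv = adversary +
  fixes st :: game
  assumes root: "[] \<in> gall st" "gch st [] = m"
    and fin: "finite (gall st)"
    and prefix: "\<And>v. \<lbrakk>v \<in> gall st; v \<noteq> []\<rbrakk> \<Longrightarrow> butlast v \<in> gall st \<and> last v < gch st (butlast v)"
    and pos: "\<And>a. gpos st a \<in> gvis st a"
    and vis: "\<And>a. gvis st a \<subseteq> gall st" "\<And>a. [] \<in> gvis st a"
    and vis_prefix: "\<And>a v. v \<in> gvis st a \<Longrightarrow> butlast v \<in> gvis st a"
    and cost: "\<And>a. 2 * card (gvis st a) \<le> gused st a + length (gpos st a) + 2"
    and depth: "\<And>a. length (gpos st a) \<le> gused st a"
    and used: "\<And>a. gused st a \<le> B"
    and disc: "\<And>v. \<lbrakk>v \<in> gall st; v \<noteq> []\<rbrakk> \<Longrightarrow> gdisc st v < k \<and> v \<in> gvis st (gdisc st v)"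
    and ell: "\<And>a i. gell st a = Some i \<Longrightarrow> i < m \<and> a < k \<and> (\<exists>x\<in>gvis st a. length x = s \<and> hd x = i)"
    and ell_None: "\<And>a x. \<lbrakk>gell st a = None; x \<in> gvis st a\<rbrakk> \<Longrightarrow> length x < s"
    and own: "\<And>i a. gown st i = Some a \<Longrightarrow> gell st a = Some i"
    and own_ex: "\<And>a i. gell st a = Some i \<Longrightarrow> gown st i \<noteq> None"
    and fl: "gfl st \<subseteq> {..<m}" "gfl st \<noteq> {..<m}"
    and fl_ex: "\<And>i. i \<in> gfl st \<Longrightarrow> \<exists>a. gell st a = Some i \<and> gown st i \<noteq> Some a"
    and exempt: "\<And>a i j. \<lbrakk>gell st a = Some i; gown st i \<noteq> Some a; i \<notin> gfl st; j < m; j \<noteq> i\<rbrakk>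
                   \<Longrightarrow> j \<in> gfl st"
    and ch_leg: "\<And>v. \<lbrakk>v \<in> gall st; v \<noteq> []; length v < s\<rbrakk> \<Longrightarrow> gch st v = 1"
    and ch_u: "\<And>v. \<lbrakk>v \<in> gall st; length v = s\<rbrakk> \<Longrightarrow> gch st v = N"
    and ch_own: "\<And>v. \<lbrakk>v \<in> gall st; s < length v; length v \<le> T; gown st (hd v) = Some (gdisc st v)\<rbrakk>
                   \<Longrightarrow> gch st v = (if length v = T then N else 1)"
    and ch_other: "\<And>v. \<lbrakk>v \<in> gall st; s < length v; length v \<le> T; gown st (hd v) \<noteq> Some (gdisc st v)\<rbrakk>
                   \<Longrightarrow> gch st v \<le> 1 \<and> (s + \<sigma> \<le> length v \<longrightarrow> gch st v = 0) \<and>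
                        (hd v \<notin> gfl st \<and> length v < s + \<sigma> \<longrightarrow> gch st v = 1)"
    and ch_deep: "\<And>v. \<lbrakk>v \<in> gall st; T < length v\<rbrakk>
                   \<Longrightarrow> length v \<le> T + \<sigma> \<and> gch st v \<le> 1 \<and> (length v = T + \<sigma> \<longrightarrow> gch st v = 0) \<and>
                        (take T v \<notin> gtf st \<and> length v < T + \<sigma> \<longrightarrow> gch st v = 1)"
    and tf_conf: "\<And>a i x. \<lbrakk>gell st a = Some i; gown st i \<noteq> Some a; confined st a i;
                     x \<in> gvis st a; length x = T; gch st x \<noteq> 0\<rbrakk> \<Longrightarrow> x \<in> gtf st"
    and leaf_conf: "\<And>a i v. \<lbrakk>gell st a = Some i; gown st i \<noteq> Some a; i \<in> gfl st; confined st a i;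
                     v \<in> gall st; s < length v; gdisc st v = a\<rbrakk> \<Longrightarrow> gch st v = 0"
    and tf_ex: "\<And>x. x \<in> gtf st \<Longrightarrow> \<exists>a. gell st a = Some (hd x) \<and> gown st (hd x) \<noteq> Some a \<and>
                   confined st a (hd x) \<and>
                   (if gpos st a \<noteq> [] \<and> hd (gpos st a) = hd x
                    then 2 * T \<le> gused st a + length (gpos st a)
                    else 2 * T + length (gpos st a) \<le> gused st a)"

lemma (in adversary) start_inv: "game_inv m k s T \<sigma> N B start"
proof -
  have "0 \<in> {..<m}" using m_pos by simp
  then have "{} \<noteq> {..<m}" by blast
  then show ?thesis
    using s_pos by unfold_locales (auto simp: start_def)
qed

section \<open>Preservation of the invariant\<close>

context game_inv
begin

lemma all_take: "x \<in> gall st \<Longrightarrow> take n x \<in> gall st"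
proof (induction x rule: rev_induct)
  case (snoc y ys)
  then show ?case using prefix[of "ys @ [y]"] by (cases "n \<le> length ys") auto
qed simp

lemma vis_take: "x \<in> gvis st a \<Longrightarrow> take n x \<in> gvis st a"
proof (induction x rule: rev_induct)
  case (snoc y ys)
  then show ?case using vis_prefix[of "ys @ [y]"] by (cases "n \<le> length ys") auto
qed simp

lemma all_nth: "x \<in> gall st \<Longrightarrow> n < length x \<Longrightarrow> x ! n < gch st (take n x)"
  using prefix[OF all_take[of x "Suc n"]] by (auto simp: take_Suc_conv_app_nth)

lemma hd_less: "x \<in> gall st \<Longrightarrow> x \<noteq> [] \<Longrightarrow> hd x < m"
  using all_nth[of x 0] root by (simp add: hd_conv_nth)

lemma finite_vis: "finite (gvis st a)"
  using vis(1) fin by (rule finite_subset)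

lemma not_disc:
  assumes "gell st a = None" "x \<in> gall st" "s \<le> length x"
  shows "gdisc st x \<noteq> a"
  using disc[of x] ell_None[OF assms(1), of x] assms s_pos by fastforce

text \<open>Old vertices keep their children and discoverer, so the clauses need an argument only
  for the possibly new vertex \<open>v\<close>, for the moving agent \<open>a\<close>, and where
  \<open>gell\<close>, \<open>gown\<close>, \<open>gfl\<close> or \<open>gtf\<close> grow.\<close>

lemma move_inv:
  assumes a: "a < k" and p: "p < deg (gch st) (gpos st a)" and e: "gused st a < B"
  shows "game_inv m k s T \<sigma> N B (move st a p)"
proof -
  define u where "u = gpos st a"
  define v where "v = nbr (gch st) u p"
  define st' where "st' = move st a p"
  have fields: "gpos st' = (gpos st)(a := v)"
    "gused st' = (gused st)(a := gused st a + 1)"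
    "gvis st' = (gvis st)(a := insert v (gvis st a))"
    "gall st' = insert v (gall st)"
    "gch st' = (if v \<in> gall st then gch st else (gch st)(v := new_ch st a v))"
    "gdisc st' = (if v \<in> gall st then gdisc st else (gdisc st)(v := a))"
    "gell st' = (if length v = s \<and> gell st a = None then (gell st)(a := Some (hd v)) else gell st)"
    "gown st' = (if (length v = s \<and> gell st a = None) \<and> gown st (hd v) = None
                 then (gown st)(hd v := Some a) else gown st)"
    "gfl st' = (if (length v = s \<and> gell st a = None) \<and> gown st (hd v) \<noteq> None \<and>
                   (\<exists>j<m. j \<noteq> hd v \<and> j \<notin> gfl st)
                then insert (hd v) (gfl st) else gfl st)"
    "gtf st' = (if length v = T \<and> v \<in> gall st \<and> gch st v \<noteq> 0 \<and> gell st a = Some (hd v) \<and>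
                   gown st (hd v) \<noteq> Some a \<and> confined st a (hd v)
                then insert v (gtf st) else gtf st)"
    unfolding st'_def v_def u_def by (simp_all add: move_def Let_def)
  have u: "u \<in> gvis st a" "u \<in> gall st" using pos vis u_def by auto
  have dir: "(v = u @ [p] \<and> p < gch st u) \<or> (u \<noteq> [] \<and> v = butlast u)"
    using p unfolding v_def u_def[symmetric] nbr_def deg_def by (auto split: if_splits)
  have up_vis: "butlast u \<in> gvis st a" "butlast u \<in> gall st"
    using vis_prefix[OF u(1)] vis by auto
  have v_new: "v = u @ [p]" "p < gch st u" if "v \<notin> gall st"
    using dir up_vis that by auto
  have v_last: "butlast v \<in> gvis st a \<and> last v < gch st (butlast v)" if "v \<noteq> []"
    using dir
  proof
    assume "u \<noteq> [] \<and> v = butlast u"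
    then show ?thesis using up_vis vis_prefix[of v a] prefix[of v] that by auto
  qed (use u in auto)
  have butlast_v: "butlast v \<in> gvis st a" "butlast v \<in> gall st"
    using v_last vis by (cases "v = []"; auto)+
  have ch_old: "gch st' x = gch st x" "gdisc st' x = gdisc st x" if "x \<in> gall st" for x
    using that by (auto simp: fields)
  have ch_new: "gch st' v = new_ch st a v" "gdisc st' v = a" if "v \<notin> gall st"
    using that by (auto simp: fields)
  have all_cases: "x \<in> gall st \<or> (x = v \<and> v \<notin> gall st)" if "x \<in> gall st'" for x
    using that by (auto simp: fields)
  have own_mono: "gown st' i = gown st i" if "gown st i \<noteq> None" for i
    using that by (auto simp: fields)
  have own_new: "gown st i = Some b \<or>
      (b = a \<and> i = hd v \<and> length v = s \<and> gell st a = None \<and> gown st i = None)"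
    if "gown st' i = Some b" for i b
    using that by (auto simp: fields split: if_splits)
  have own_neq: "gown st i \<noteq> Some b" if "gown st' i \<noteq> Some b" for i b
    using that own_mono[of i] by auto
  have ell_new: "gell st b = Some i \<or> (b = a \<and> i = hd v \<and> length v = s \<and> gell st a = None)"
    if "gell st' b = Some i" for i b
    using that by (auto simp: fields split: if_splits)
  have ell_mono: "gell st' b = Some i" if "gell st b = Some i" for i b
    using that by (auto simp: fields)
  have fl_mono: "i \<in> gfl st'" if "i \<in> gfl st" for i using that by (simp add: fields)
  have tf_mono: "i \<in> gtf st'" if "i \<in> gtf st" for i using that by (simp add: fields)
  have vis_mono: "x \<in> gvis st' b" if "x \<in> gvis st b" for x b using that by (auto simp: fields)
  have conf_mono: "confined st b i" if "confined st' b i" for b i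
    using that vis_mono unfolding confined_def by blast
  \<comment> \<open>An agent becomes an owner on its first arrival at depth \<open>s\<close>, before
    it has discovered anything deeper. So no old vertex changes sides between owner and
    non-owner.\<close>
  have own_iff: "gown st' (hd x) = Some (gdisc st' x) \<longleftrightarrow> gown st (hd x) = Some (gdisc st x)"
    if "x \<in> gall st" "s < length x" for x
    using own_new[of "hd x" "gdisc st x"] own_mono[of "hd x"] not_disc[of a x] that ch_old(2)[of x]
    by fastforce
  have hd_v: "hd v < m" if "v \<noteq> []"
  proof (cases "butlast v = []")
    case True
    then have "v = [last v]" using that by (metis append_Nil append_butlast_last_id)
    then show ?thesis using v_last[OF that] True root(2) by (metis list.sel(1))
  next
    case False
    then have "hd v = hd (butlast v)" using that by (metis append_butlast_last_id hd_append2)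
    then show ?thesis using hd_less[OF butlast_v(2) False] by simp
  qed
  have depth': "length v \<le> gused st a + 1" using depth[of a] dir by (auto simp: u_def[symmetric])
  have big: "s < length v \<Longrightarrow> gown st' = gown st \<and> gfl st' = gfl st \<and> gell st' = gell st"
    by (simp add: fields)
  show ?thesis unfolding st'_def[symmetric]
  proof unfold_locales
    show "[] \<in> gall st'" "gch st' [] = m" "finite (gall st')"
      using root ch_old[of "[]"] fin by (auto simp: fields)
    show "butlast x \<in> gall st' \<and> last x < gch st' (butlast x)" if "x \<in> gall st'" "x \<noteq> []" for x
      using all_cases[OF that(1)]
    proof
      assume "x \<in> gall st"
      then show ?thesis using prefix[of x] that ch_old by (auto simp: fields)
    next
      assume "x = v \<and> v \<notin> gall st"
      then show ?thesis using v_last that ch_old[OF butlast_v(2)] butlast_v by (auto simp: fields)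
    qed
    show "gpos st' b \<in> gvis st' b" "gvis st' b \<subseteq> gall st'" "[] \<in> gvis st' b" for b
      using pos[of b] vis[of b] by (auto simp: fields)
    show "butlast x \<in> gvis st' b" if "x \<in> gvis st' b" for b x
      using that vis_prefix[of x b] butlast_v by (auto simp: fields split: if_splits)
    \<comment> \<open>A move down adds 2 on the right and at most one vertex on the left; a move up
      leads to a visited vertex and changes neither side.\<close>
    show "2 * card (gvis st' b) \<le> gused st' b + length (gpos st' b) + 2" for b
    proof (cases "b = a")
      case True
      have "card (insert v (gvis st a)) \<le> card (gvis st a) + (if v \<in> gvis st a then 0 else 1)"
        using finite_vis[of a] by (simp add: card_insert_if)
      moreover have "v \<notin> gvis st a \<Longrightarrow> v = u @ [p]" using dir up_vis by auto
      moreover have "length v = length u + 1 \<or> length v + 1 = length u" using dir by auto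
      ultimately show ?thesis using cost[of a] True
        by (auto simp: fields u_def[symmetric] split: if_splits)
    qed (use cost[of b] in \<open>simp add: fields\<close>)
    show "length (gpos st' b) \<le> gused st' b" for b
      using depth[of b] depth' by (auto simp: fields)
    show "gused st' b \<le> B" for b using used[of b] e by (auto simp: fields)
    show "gdisc st' x < k \<and> x \<in> gvis st' (gdisc st' x)" if "x \<in> gall st'" "x \<noteq> []" for x
      using all_cases[OF that(1)]
    proof
      assume "x \<in> gall st"
      then show ?thesis using disc[of x] that ch_old vis_mono by auto
    next
      assume "x = v \<and> v \<notin> gall st"
      then show ?thesis using ch_new a by (simp add: fields(3))
    qed
    show "i < m \<and> b < k \<and> (\<exists>x\<in>gvis st' b. length x = s \<and> hd x = i)" if "gell st' b = Some i" for b i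
      using ell_new[OF that]
    proof
      assume "gell st b = Some i"
      then show ?thesis using ell[of b i] vis_mono by blast
    next
      assume *: "b = a \<and> i = hd v \<and> length v = s \<and> gell st a = None"
      then have "v \<noteq> []" using s_pos by auto
      with * hd_v a show ?thesis by (auto simp: fields(3))
    qed
    show "length x < s" if "gell st' b = None" "x \<in> gvis st' b" for b x
    proof (cases "x \<in> gvis st b")
      case True
      have "gell st b = None" using that(1) ell_mono by (metis not_None_eq)
      then show ?thesis using ell_None True by blast
    next
      case False
      then have x: "x = v" "b = a" using that(2) by (auto simp: fields(3) split: if_splits)
      have n: "gell st a = None" using that(1) ell_mono x by (metis not_None_eq)
      then have "length v \<noteq> s" using that(1) x by (auto simp: fields(7))
      \<comment> \<open>So far the agent has stayed above depth \<open>s\<close>, so one move cannot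
        carry it past that depth.\<close>
      moreover have "length u < s" using ell_None[OF n u(1)] .
      ultimately show ?thesis using dir x by auto
    qed
    show "gell st' b = Some i" if "gown st' i = Some b" for b i
      using own_new[OF that]
    proof
      assume "gown st i = Some b" then show ?thesis using own ell_mono by blast
    qed (simp add: fields)
    show "gown st' i \<noteq> None" if "gell st' b = Some i" for b i
      using ell_new[OF that] own_ex[of b i] own_mono[of i] by (auto simp: fields)
    show "gfl st' \<subseteq> {..<m}"
    proof -
      have "length v = s \<Longrightarrow> hd v < m" using s_pos hd_v by (cases v) auto
      then show ?thesis using fl(1) by (auto simp: fields)
    qed
    show "gfl st' \<noteq> {..<m}"
    proof (cases "gfl st' = gfl st")
      case False
      then have c: "(length v = s \<and> gell st a = None) \<and> gown st (hd v) \<noteq> None \<and>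
          (\<exists>j<m. j \<noteq> hd v \<and> j \<notin> gfl st)"
        unfolding fields(9) by (rule contrapos_np) (rule if_not_P)
      then have "gfl st' = insert (hd v) (gfl st)" unfolding fields(9) by (rule if_P)
      with c obtain j where "j < m" "j \<noteq> hd v" "j \<notin> gfl st" "gfl st' = insert (hd v) (gfl st)"
        by blast
      then show ?thesis by auto
    qed (use fl in simp)
    show "\<exists>b. gell st' b = Some i \<and> gown st' i \<noteq> Some b" if "i \<in> gfl st'" for i
    proof (cases "i \<in> gfl st")
      case True
      then obtain b where b: "gell st b = Some i" "gown st i \<noteq> Some b" using fl_ex by blast
      then show ?thesis using ell_mono own_mono own_ex by metis
    next
      case False
      then have i: "i = hd v" "length v = s" "gell st a = None" "gown st i \<noteq> None"
        using that by (auto simp: fields split: if_splits)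
      then have "gown st i \<noteq> Some a" using own by fastforce
      then show ?thesis using i own_mono[of i] by (intro exI[of _ a]) (simp add: fields(7))
    qed
    show "j \<in> gfl st'"
      if "gell st' b = Some i" "gown st' i \<noteq> Some b" "i \<notin> gfl st'" "j < m" "j \<noteq> i" for b i j
      using ell_new[OF that(1)]
    proof
      assume "gell st b = Some i"
      then have "j \<in> gfl st" using exempt that own_neq fl_mono by metis
      then show ?thesis using fl_mono by blast
    next
      assume *: "b = a \<and> i = hd v \<and> length v = s \<and> gell st a = None"
      with that(2) have "gown st (hd v) \<noteq> None" by (cases "gown st (hd v)") (auto simp: fields)
      with * that(3-5) have "j \<in> gfl st" by (auto simp: fields split: if_splits)
      then show ?thesis using fl_mono by blast
    qed
    show "gch st' x = 1" if "x \<in> gall st'" "x \<noteq> []" "length x < s" for x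
      using all_cases[OF that(1)] ch_leg[of x] ch_old ch_new that by (auto simp: new_ch_def)
    show "gch st' x = N" if "x \<in> gall st'" "length x = s" for x
      using all_cases[OF that(1)] ch_u[of x] ch_old ch_new that by (auto simp: new_ch_def)
    show "gch st' x = (if length x = T then N else 1)"
      if "x \<in> gall st'" "s < length x" "length x \<le> T" "gown st' (hd x) = Some (gdisc st' x)" for x
      using all_cases[OF that(1)]
    proof
      assume "x \<in> gall st"
      then show ?thesis using ch_own[of x] own_iff that ch_old by auto
    next
      assume *: "x = v \<and> v \<notin> gall st"
      then have "gown st (hd v) = Some a" using that big ch_new by auto
      then show ?thesis using * that ch_new by (simp add: new_ch_def)
    qed
    show "gch st' x \<le> 1 \<and> (s + \<sigma> \<le> length x \<longrightarrow> gch st' x = 0) \<and>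
          (hd x \<notin> gfl st' \<and> length x < s + \<sigma> \<longrightarrow> gch st' x = 1)"
      if "x \<in> gall st'" "s < length x" "length x \<le> T" "gown st' (hd x) \<noteq> Some (gdisc st' x)" for x
      using all_cases[OF that(1)]
    proof
      assume "x \<in> gall st"
      then show ?thesis using ch_other[of x] own_iff that ch_old fl_mono by metis
    next
      assume *: "x = v \<and> v \<notin> gall st"
      then have "gown st (hd v) \<noteq> Some a" "gfl st' = gfl st" using that big ch_new by auto
      then show ?thesis using * that ch_new by (simp add: new_ch_def)
    qed
    show "length x \<le> T + \<sigma> \<and> gch st' x \<le> 1 \<and> (length x = T + \<sigma> \<longrightarrow> gch st' x = 0) \<and>
          (take T x \<notin> gtf st' \<and> length x < T + \<sigma> \<longrightarrow> gch st' x = 1)"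
      if "x \<in> gall st'" "T < length x" for x
      using all_cases[OF that(1)]
    proof
      assume "x \<in> gall st"
      then show ?thesis using ch_deep[of x] that ch_old tf_mono by metis
    next
      assume *: "x = v \<and> v \<notin> gall st"
      then have "length v \<le> T + \<sigma>"
        using v_new ch_deep[of u] u that(2) \<sigma>_pos by (cases "T < length u") auto
      then show ?thesis using * that ch_new T_large by (auto simp: new_ch_def fields(10))
    qed
    show "x \<in> gtf st'"
      if "gell st' b = Some i" "gown st' i \<noteq> Some b" "confined st' b i" "x \<in> gvis st' b"
        "length x = T" "gch st' x \<noteq> 0" for b i x
    proof (cases "x \<in> gvis st b \<and> gell st b = Some i")
      case True
      then have "gch st x \<noteq> 0" using that(6) vis(1)[of b] ch_old by (metis subsetD)
      then have "x \<in> gtf st" using tf_conf True that own_neq conf_mono by metis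
      then show ?thesis using tf_mono by blast
    next
      case False
      show ?thesis
      proof (cases "gell st b = Some i")
        case True
        with False that(4) have x: "x = v" "b = a" by (auto simp: fields(3) split: if_splits)
        have i: "i = hd v"
          using that(3,5) x T_large unfolding confined_def by (auto simp: fields(3))
        have o: "gown st (hd v) \<noteq> Some a" using own_neq that(2) x i by blast
        show ?thesis
        proof (cases "v \<in> gall st")
          case v: True
          then show ?thesis
            using True x i o that(5,6) ch_old[OF v] conf_mono[OF that(3)] by (simp add: fields(10))
        next
          case v: False
          \<comment> \<open>This case is contradictory: a vertex at depth \<open>T\<close>
            discovered by a non-owner gets no children, as \<open>s + \<sigma> < T\<close>.\<close>
          then show ?thesis
            using that(5,6) x o ch_new T_large by (simp add: new_ch_def)
        qed
      next
        case no: False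
        then have *: "b = a" "length v = s" "gell st a = None" using ell_new[OF that(1)] by auto
        then have "length x < s \<or> x = v"
          using that(4) ell_None[OF *(3), of x] by (auto simp: fields(3))
        then show ?thesis using that(5) * T_large by auto
      qed
    qed
    show "gch st' x = 0"
      if "gell st' b = Some i" "gown st' i \<noteq> Some b" "i \<in> gfl st'" "confined st' b i"
        "x \<in> gall st'" "s < length x" "gdisc st' x = b" for b i x
      using all_cases[OF that(5)]
    proof
      assume x: "x \<in> gall st"
      then have d: "gdisc st x = b" using that(7) ch_old by simp
      then have old: "gell st b = Some i"
        using ell_new[OF that(1)] not_disc[OF _ x, of a] that(6) by auto
      have o: "gown st i \<noteq> Some b" using own_neq that(2) by blast
      \<comment> \<open>The leg cannot have been flagged by this very move: by
        \<open>exempt\<close>, a non-owner such as \<open>b\<close> on an unflagged leg means that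
        all other legs are flagged, and then the rule forbids flagging this one.\<close>
      have "i \<in> gfl st"
      proof (rule ccontr)
        assume n: "i \<notin> gfl st"
        with \<open>i \<in> gfl st'\<close> have "\<exists>j<m. j \<noteq> i \<and> j \<notin> gfl st"
          by (auto simp: fields(9) split: if_splits)
        then obtain j where "j < m" "j \<noteq> i" "j \<notin> gfl st" by blast
        then show False using exempt[OF old o n] by blast
      qed
      then show ?thesis
        using leaf_conf[OF old o _ conf_mono[OF that(4)] x that(6) d] ch_old[OF x] by simp
    next
      assume x: "x = v \<and> v \<notin> gall st"
      then have ba: "b = a" using that(7) ch_new by simp
      have L: "s < length v" using that x by simp
      have old: "gell st a = Some i" and fl': "i \<in> gfl st" using that big[OF L] ba by auto
      have i: "i = hd v" using that(4) L ba x unfolding confined_def by (auto simp: fields(3))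
      have o: "gown st i \<noteq> Some a" using own_neq that(2) ba by blast
      have c: "confined st a i" using conf_mono[OF that(4)] ba by simp
      \<comment> \<open>To get below depth \<open>T\<close> the agent passed a vertex with children
        at depth \<open>T\<close>, which by \<open>tf_conf\<close> is closed.\<close>
      have "take T v \<in> gtf st" if LT: "T < length v"
      proof -
        have g: "take T v = take T u" "T \<le> length u" using v_new x LT by auto
        have "gch st (take T u) \<noteq> 0"
          using v_new x all_nth[OF u(2), of T] g by (cases "T = length u") auto
        then show ?thesis using tf_conf[OF old o c vis_take[OF u(1)], of T] g by simp
      qed
      then show ?thesis using x ch_new L o i fl' by (auto simp: new_ch_def)
    qed
    show "\<exists>b. gell st' b = Some (hd x) \<and> gown st' (hd x) \<noteq> Some b \<and> confined st' b (hd x) \<and>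
        (if gpos st' b \<noteq> [] \<and> hd (gpos st' b) = hd x
         then 2 * T \<le> gused st' b + length (gpos st' b)
         else 2 * T + length (gpos st' b) \<le> gused st' b)" if x: "x \<in> gtf st'" for x
    proof (cases "x \<in> gtf st")
      case True
      then obtain b where b: "gell st b = Some (hd x)" "gown st (hd x) \<noteq> Some b"
        "confined st b (hd x)"
        and len: "if gpos st b \<noteq> [] \<and> hd (gpos st b) = hd x
           then 2 * T \<le> gused st b + length (gpos st b)
           else 2 * T + length (gpos st b) \<le> gused st b"
        using tf_ex by blast
      have b': "gell st' b = Some (hd x)" "gown st' (hd x) \<noteq> Some b"
        using b ell_mono own_ex[OF b(1)] own_mono by auto
      show ?thesis
      proof (cases "b = a")
        case False
        then show ?thesis using b b' len
          by (intro exI[of _ b]) (simp add: fields(1-3) confined_def)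
      next
        case ba: True
        have len: "if u \<noteq> [] \<and> hd u = hd x then 2 * T \<le> gused st a + length u
           else 2 * T + length u \<le> gused st a" using len unfolding ba u_def .
        \<comment> \<open>Going down from depth at least \<open>s\<close> in another leg would
          require \<open>2 * T + s \<le> gused st a < B\<close>, against
          \<open>B_le\<close>.\<close>
        have "hd v = hd x" if "s < length v"
          using dir
        proof
          assume d: "v = u @ [p] \<and> p < gch st u"
          then have "s \<le> length u" "u \<noteq> []" using that s_pos by auto
          then have "hd u = hd x" using len e B_le by (auto split: if_splits)
          then show ?thesis using d \<open>u \<noteq> []\<close> by simp
        next
          assume d: "u \<noteq> [] \<and> v = butlast u"
          then have "s < length u" using that by auto
          then have "hd u = hd x" using b(3) u ba unfolding confined_def by blast
          moreover have "hd v = hd u" using d that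
            by (metis append_butlast_last_id hd_append2 length_0_conv less_nat_zero_code)
          ultimately show ?thesis by simp
        qed
        then have "confined st' a (hd x)" using b(3) ba by (auto simp: confined_def fields(3))
        \<comment> \<open>In the leg of \<open>x\<close> a move up trades a unit of depth for a used
          edge, and elsewhere a move down does; the other moves only help. At the root both forms
          agree.\<close>
        moreover have "if v \<noteq> [] \<and> hd v = hd x then 2 * T \<le> gused st a + 1 + length v
           else 2 * T + length v \<le> gused st a + 1"
          using dir
        proof
          assume "v = u @ [p] \<and> p < gch st u"
          then show ?thesis using len by (cases "u = []") (auto split: if_splits)
        next
          assume d: "u \<noteq> [] \<and> v = butlast u"
          then have "v \<noteq> [] \<Longrightarrow> hd v = hd u" "length v = length u - 1" "length u \<ge> 1"
            by (metis append_butlast_last_id hd_append2) (use d in \<open>auto simp: Suc_le_eq\<close>)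
          moreover have "length u = 1" if "v = []" using that d
            by (metis append_Nil append_butlast_last_id length_Cons list.size(3) One_nat_def)
          ultimately show ?thesis using len d by (cases "v = []") (auto split: if_splits)
        qed
        ultimately show ?thesis using b' ba by (intro exI[of _ a]) (auto simp: fields(1,2) split: if_splits)
      qed
    next
      case False
      then have v: "x = v" "length v = T" "gell st a = Some (hd v)" "gown st (hd v) \<noteq> Some a"
        "confined st a (hd v)" using x by (auto simp: fields(10) split: if_splits)
      have "T \<noteq> s" using T_large by simp
      then have "gell st' a = Some (hd v)" "gown st' (hd v) \<noteq> Some a"
        using v by (auto simp: fields(7,8))
      moreover have "confined st' a (hd v)" using v(5) by (auto simp: confined_def fields(3))
      moreover have "v \<noteq> []" using v T_large by auto
      \<comment> \<open>The agent that closes \<open>v\<close> is itself the witness: it stands at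
        depth \<open>T\<close> and has by now used at least \<open>T\<close> edges.\<close>
      ultimately show ?thesis using v depth'
        by (intro exI[of _ a]) (simp add: fields(1,2))
    qed
  qed
qed

end

section \<open>The game against an online algorithm\<close>

context adversary
begin

lemma move_simps:
  "gpos (move st a p) = (gpos st)(a := nbr (gch st) (gpos st a) p)"
  "gused (move st a p) = (gused st)(a := gused st a + 1)"
  "gall (move st a p) = insert (nbr (gch st) (gpos st a) p) (gall st)"
  "gch (move st a p) = (if nbr (gch st) (gpos st a) p \<in> gall st then gch st
     else (gch st)(nbr (gch st) (gpos st a) p := new_ch st a (nbr (gch st) (gpos st a) p)))"
  by (simp_all add: move_def Let_def)

lemma ghist_move:
  assumes "u = gpos st a" "v = nbr (gch st) u p" "ch = gch (move st a p)"
  shows "ghist (move st a p) =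
     ghist st @ [Obs a p (if length u < length v then ch v else last u) (deg ch v)]"
  using assms by (simp add: move_def Let_def)

text \<open>The game is played without a tree: the algorithm sees only \<open>k\<close>,
  \<open>B\<close>, the degree \<open>m\<close> of the root and the history, so the adversary can
  answer adaptively.\<close>

definition gstep :: "online_algorithm \<Rightarrow> game \<Rightarrow> game" where
  "gstep A st = (case A k B m (ghist st) of None \<Rightarrow> st
     | Some (a, p) \<Rightarrow> if a < k \<and> p < deg (gch st) (gpos st a) \<and> gused st a < B
                        then move st a p else st)"

definition grun :: "online_algorithm \<Rightarrow> nat \<Rightarrow> game" where
  "grun A n = (gstep A ^^ n) start"

lemma grun_simps [simp]: "grun A 0 = start" "grun A (Suc n) = gstep A (grun A n)"
  by (simp_all add: grun_def)

lemma grun_inv: "game_inv m k s T \<sigma> N B (grun A n)"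
proof (induction n)
  case (Suc n)
  then show ?case
    by (auto simp: gstep_def split: option.split intro: game_inv.move_inv)
qed (simp add: start_inv)

text \<open>Answers are never revised, so a tree chosen at the end can reproduce the whole
  run.\<close>

lemma grun_mono:
  assumes "n \<le> M"
  shows "gall (grun A n) \<subseteq> gall (grun A M) \<and>
         (\<forall>x \<in> gall (grun A n). gch (grun A M) x = gch (grun A n) x)"
  using assms
proof (induction M rule: dec_induct)
  case (step M)
  have "gall st \<subseteq> gall (gstep A st) \<and> (\<forall>x \<in> gall st. gch (gstep A st) x = gch st x)" for st
    by (auto simp: gstep_def move_simps split: option.split)
  from this[of "grun A M"] show ?case using step.IH by auto
qed simp

text \<open>Every step that changes the state uses one edge of the total budget
  \<open>k * B\<close>.\<close>

lemma grun_stabilizes: "\<exists>M. gstep A (grun A M) = grun A M"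
proof (rule ccontr)
  assume "\<not> ?thesis"
  then have ne: "gstep A (grun A n) \<noteq> grun A n" for n by blast
  have "(\<Sum>a<k. gused (grun A n) a) = n" for n
  proof (induction n)
    case (Suc n)
    obtain a p where "a < k" "gstep A (grun A n) = move (grun A n) a p"
      using ne[of n] by (auto simp: gstep_def split: option.splits if_splits)
    then have "(\<Sum>b<k. gused (grun A (Suc n)) b) =
        (\<Sum>b<k. gused (grun A n) b + (if b = a then 1 else 0))"
      by (intro sum.cong) (auto simp: move_simps)
    then show ?case using Suc \<open>a < k\<close> by (simp add: sum.distrib)
  qed (simp add: start_def)
  moreover have "(\<Sum>a<k. gused (grun A n) a) \<le> k * B" for n
    using sum_bounded_above[of "{..<k}" "gused (grun A n)" B]
      game_inv.used[OF grun_inv] by simp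
  ultimately show False by (metis Suc_n_not_le_n)
qed

definition config_of :: "game \<Rightarrow> config" where
  "config_of st = \<lparr> cpos = to_nat \<circ> gpos st, cused = gused st,
                    cvisited = to_nat ` gall st, chist = ghist st \<rparr>"

lemma in_addresses:
  assumes "game_inv m k s T \<sigma> N B st" "\<And>x. x \<in> gall st \<Longrightarrow> ch x = gch st x"
  shows "gall st \<subseteq> addresses ch"
  using game_inv.all_nth[OF assms(1)] game_inv.all_take[OF assms(1)] assms(2)
  by (auto simp: addresses_def)

text \<open>A step consults the tree only at the root, at the current vertex and at its target, all
  of which lie in \<open>gall (gstep A st)\<close>; so any \<open>ch\<close> that agrees with the
  adversary there yields the same observation.\<close>

lemma alg_step_config_of:
  assumes inv: "game_inv m k s T \<sigma> N B st"
    and eq: "\<And>x. x \<in> gall (gstep A st) \<Longrightarrow> ch x = gch (gstep A st) x"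
    and inv': "game_inv m k s T \<sigma> N B (gstep A st)"
    and sub: "gall st \<subseteq> gall (gstep A st)" "\<And>x. x \<in> gall st \<Longrightarrow> gch (gstep A st) x = gch st x"
  shows "alg_step A (tree_inst ch k B) (config_of st) = config_of (gstep A st)"
proof -
  let ?I = "tree_inst ch k B"
  have addr: "gall (gstep A st) \<subseteq> addresses ch" using in_addresses[OF inv' eq] by blast
  have pos: "gpos st a \<in> gall st" for a
    using game_inv.pos[OF inv] game_inv.vis(1)[OF inv] by blast
  have ch: "ch x = gch st x" "x \<in> addresses ch" if "x \<in> gall st" for x
    using that eq sub addr by auto
  have deg: "deg ch x = deg (gch st) x" if "x \<in> gall st" for x
    using ch[OF that] by (simp add: deg_def)
  have "deg ch [] = m" using ch game_inv.root[OF inv] by (simp add: deg_def)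
  then have root: "idegree ?I (iroot ?I) = m" by (simp add: idegree_tree_inst)
  have legal: "legal_move ?I (config_of st) a p \<longleftrightarrow>
      a < k \<and> p < deg (gch st) (gpos st a) \<and> gused st a < B" for a p
    using idegree_tree_inst[OF ch(2)[OF pos]] deg[OF pos] by (simp add: legal_move_def config_of_def)
  have do_move: "do_move ?I (config_of st) a p = config_of (move st a p)"
    if l: "p < deg (gch st) (gpos st a)" and g: "gstep A st = move st a p" for a p
  proof -
    define u where "u = gpos st a"
    define v where "v = nbr (gch st) u p"
    have u: "u \<in> gall st" "ch u = gch st u" "u \<in> addresses ch" using pos ch u_def by auto
    have v: "nbr ch u p = v" using u by (simp add: nbr_def v_def)
    have v': "v \<in> gall (gstep A st)" unfolding g by (simp add: move_simps v_def u_def)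
    have pt: "port_target ?I (to_nat u) p = to_nat v"
      using port_target_tree_inst[OF u(3), of p] l deg[OF u(1)] v by (simp add: u_def)
    have idg: "idegree ?I (to_nat v) = deg ch v"
      using idegree_tree_inst addr v' by blast
    have chv: "ch v = gch (move st a p) v"
      using eq[OF v'] unfolding g .
    then have dv: "deg ch v = deg (gch (move st a p)) v" by (simp add: deg_def)
    have "u \<noteq> [] \<Longrightarrow> length u - 1 < length u" "length v \<noteq> length u"
      using l by (cases u rule: rev_cases;
          auto simp: v_def nbr_def deg_def u_def[symmetric] split: if_splits)+
    then have ip: "iport ?I (to_nat v, to_nat u) = (if length u < length v then ch v else last u)"
      by auto
    have pu: "cpos (config_of st) a = to_nat u" by (simp add: config_of_def u_def)
    have "config_of (move st a p) =
      \<lparr> cpos = (cpos (config_of st))(a := to_nat v),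
        cused = (cused (config_of st))(a := cused (config_of st) a + 1),
        cvisited = insert (to_nat v) (cvisited (config_of st)),
        chist = chist (config_of st) @ [Obs a p (iport ?I (to_nat v, to_nat u)) (idegree ?I (to_nat v))] \<rparr>"
      unfolding ip idg dv chv ghist_move[OF u_def v_def refl] config_of_def move_simps
      by (simp add: u_def[symmetric] v_def[symmetric] fun_eq_iff comp_def)
    then show ?thesis
      unfolding do_move_def Let_def pu pt by simp
  qed
  show ?thesis
  proof (cases "A k B m (ghist st)")
    case None
    then show ?thesis using root by (simp add: alg_step_def gstep_def config_of_def)
  next
    case (Some q)
    obtain a p where q: "q = (a, p)" by force
    have "chist (config_of st) = ghist st" by (simp add: config_of_def)
    then show ?thesis
      using Some root legal[of a p] do_move[of p a] q
      by (auto simp: alg_step_def gstep_def)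
  qed
qed

lemma alg_value_grun:
  assumes stable: "gstep A (grun A M) = grun A M"
    and eq: "\<And>x. x \<in> gall (grun A M) \<Longrightarrow> ch x = gch (grun A M) x"
  shows "alg_value A (tree_inst ch k B) = card (gall (grun A M))"
proof -
  let ?I = "tree_inst ch k B"
  have step: "alg_step A ?I (config_of (grun A n)) = config_of (grun A (Suc n))" if "Suc n \<le> M" for n
  proof -
    have eq': "ch x = gch (grun A (Suc n)) x" if "x \<in> gall (grun A (Suc n))" for x
      using grun_mono[OF \<open>Suc n \<le> M\<close>, of A] eq that by (metis subsetD)
    have "gall (grun A n) \<subseteq> gall (grun A (Suc n))"
      "x \<in> gall (grun A n) \<Longrightarrow> gch (grun A (Suc n)) x = gch (grun A n) x" for x
      using grun_mono[of n "Suc n" A] by auto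
    then show ?thesis
      using alg_step_config_of[OF grun_inv[of A n], of A ch] eq' grun_inv[of A "Suc n"]
      unfolding grun_simps by blast
  qed
  have run: "alg_config A ?I n = config_of (grun A n)" if "n \<le> M" for n
    using that
  proof (induction n)
    case 0
    then show ?case
      by (simp add: alg_config_def init_config_def config_of_def start_def comp_def)
  next
    case (Suc n)
    then show ?case using step by (simp add: alg_config_def)
  qed
  have halt: "alg_step A ?I (config_of (grun A M)) = config_of (grun A M)"
    using alg_step_config_of[OF grun_inv[of A M], of A ch, unfolded stable] grun_inv[of A M] eq
    by blast
  have late: "alg_config A ?I (M + n) = config_of (grun A M)" for n
  proof (induction n)
    case (Suc n)
    then show ?case using halt by (simp add: alg_config_def)
  qed (simp add: run)
  have "cvisited (alg_config A ?I n) \<subseteq> to_nat ` gall (grun A M)" for n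
  proof (cases "n \<le> M")
    case True
    then show ?thesis using run[OF True] grun_mono[OF True, of A] by (auto simp: config_of_def)
  next
    case False
    then show ?thesis using late[of "n - M"] by (simp add: config_of_def)
  qed
  moreover have "cvisited (alg_config A ?I M) = to_nat ` gall (grun A M)"
    using run[of M] by (simp add: config_of_def)
  ultimately have "(\<Union>n. cvisited (alg_config A ?I n)) = to_nat ` gall (grun A M)" by blast
  then show ?thesis
    by (simp add: alg_value_def card_image inj_on_subset[OF inj_to_nat subset_UNIV])
qed

text \<open>Every port that was never used leads to a broom with \<open>k\<close> long branches.\<close>
definition completion :: "game \<Rightarrow> nat \<Rightarrow> nat list \<Rightarrow> nat" where
  "completion st H v =
     (if v \<in> gall st then gch st v
      else if butlast v \<in> gall st then k
      else if length v < H then 1 else 0)"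

end

section \<open>Shape and size of the explored tree\<close>

context game_inv
begin

text \<open>A vertex with a child is explored, or a child of an explored one, or above depth
  \<open>H\<close>. This bounds the depth, and \<open>K\<close> bounds the numbers of
  children.\<close>

lemma finite_completion: "finite (addresses (completion st H))"
proof -
  define K where "K = Max (gch st ` gall st) + k + 1"
  define L where "L = H + Max (length ` gall st) + 2"
  have K: "completion st H v \<le> K" for v
  proof (cases "v \<in> gall st")
    case True
    then have "gch st v \<le> Max (gch st ` gall st)" using fin by (intro Max_ge) auto
    then show ?thesis using True by (simp add: completion_def K_def)
  qed (simp add: completion_def K_def)
  have len: "length v \<le> Max (length ` gall st)" if "v \<in> gall st" for v
    using fin that by (intro Max_ge) auto
  have L: "length v \<le> L" if v: "v \<in> addresses (completion st H)" for v
  proof (cases v rule: rev_cases)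
    case (snoc w j)
    then have "completion st H w > 0" using v by auto
    then consider "w \<in> gall st" | "butlast w \<in> gall st" | "length w < H"
      unfolding completion_def by (metis less_numeral_extra(3))
    then show ?thesis
    proof cases
      case 1 then show ?thesis using len[of w] snoc by (simp add: L_def)
    next
      case 2 then show ?thesis using len[of "butlast w"] snoc by (simp add: L_def)
    next
      case 3 then show ?thesis using snoc by (simp add: L_def)
    qed
  qed simp
  have "addresses (completion st H) \<subseteq> {v. set v \<subseteq> {..<K + 1} \<and> length v \<le> L}"
  proof
    fix v assume v: "v \<in> addresses (completion st H)"
    have "v ! j < K + 1" if "j < length v" for j
    proof -
      have "v ! j < completion st H (take j v)" using v that by (simp add: addresses_def)
      then show ?thesis using K[of "take j v"] by linarith
    qed
    then show "v \<in> {v. set v \<subseteq> {..<K + 1} \<and> length v \<le> L}"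
      using L[OF v] by (auto simp: set_conv_nth)
  qed
  then show ?thesis using finite_lists_length_le[of "{..<K + 1}" L] finite_subset by blast
qed

definition unexplored :: "nat list \<Rightarrow> bool" where
  "unexplored x \<longleftrightarrow> x \<noteq> [] \<and> x \<notin> gall st \<and> butlast x \<in> gall st \<and> last x < gch st (butlast x)"

definition dead :: "nat set" where
  "dead = {i. i < m \<and> (\<forall>x. unexplored x \<longrightarrow> hd x \<noteq> i)}"

definition found :: "nat \<Rightarrow> nat list set" where
  "found a = {v \<in> gall st. s < length v \<and> gdisc st v = a}"

text \<open>Visits that cost the agent budget but gain nothing, because the owner of the leg was
  there first.\<close>

definition retraced :: "nat \<Rightarrow> nat list set" where
  "retraced a = {v \<in> gvis st a. s < length v \<and> gown st (hd v) = Some (gdisc st v) \<and> gdisc st v \<noteq> a}"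

lemma finite_found: "finite (found a)" and finite_retraced: "finite (retraced a)"
  using fin finite_vis by (auto simp: found_def retraced_def)

lemma hd_take: "0 < n \<Longrightarrow> hd (take n x) = hd x"
  by (cases x; cases n) auto

lemma card_vis: "card (gvis st a) \<le> B + 1"
proof -
  have "2 * card (gvis st a) \<le> 2 * B + 2" using cost[of a] depth[of a] used[of a] by simp
  then show ?thesis by simp
qed

lemma card_all: "card (gall st) \<le> k * B + 1"
proof -
  have "gall st \<subseteq> {[]} \<union> (\<Union>a<k. gvis st a - {[]})" using disc by auto
  then have "card (gall st) \<le> card ({[]} \<union> (\<Union>a<k. gvis st a - {[]}))"
    by (intro card_mono) (auto simp: finite_vis)
  also have "\<dots> \<le> card {[] :: nat list} + card (\<Union>a<k. gvis st a - {[]})" by (rule card_Un_le)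
  also have "card (\<Union>a<k. gvis st a - {[]}) \<le> (\<Sum>a<k. card (gvis st a - {[]}))"
    by (rule card_UN_le) simp
  also have "\<dots> \<le> (\<Sum>a<k. B)"
    using card_vis vis(2) by (intro sum_mono) (simp add: finite_vis card_Diff_singleton le_diff_conv)
  finally show ?thesis by simp
qed

lemma length_le: "v \<in> gall st \<Longrightarrow> length v \<le> T + \<sigma>"
  using ch_deep[of v] by (cases "T < length v") auto

text \<open>A branch led by anybody else ends at depth \<open>s + \<sigma>\<close> at the
  latest.\<close>

lemma gadget_own:
  assumes "v \<in> gall st" "s + \<sigma> \<le> length v" "length v \<le> T" "gch st v \<noteq> 0"
  shows "gown st (hd v) = Some (gdisc st v)"
  using ch_other[of v] assms \<sigma>_pos by (cases "gown st (hd v) = Some (gdisc st v)") auto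

lemma gadget_ch:
  assumes "v \<in> gall st" "length v = T" "gch st v \<noteq> 0"
  shows "gch st v = N"
  using gadget_own[OF assms(1) _ _ assms(3)] ch_own[of v] assms T_large by simp

text \<open>The explored tree branches only at the root, at depth \<open>s\<close> and at depth
  \<open>T\<close>. So an address is determined by its length and its entries at these three
  depths.\<close>

lemma nth_zero:
  assumes "v \<in> gall st" "0 < n" "n < length v" "n \<noteq> s" "n \<noteq> T"
  shows "v ! n = 0"
proof -
  let ?w = "take n v"
  have w: "?w \<in> gall st" "length ?w = n" using all_take assms by auto
  have "gch st ?w \<le> 1"
  proof -
    consider "n < s" | "s < n" "n < T" | "T < n" using assms by linarith
    then show ?thesis
    proof cases
      case 1
      moreover have "?w \<noteq> []" using w(2) assms(2) by (metis less_numeral_extra(3) list.size(3))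
      ultimately show ?thesis using ch_leg[OF w(1)] w(2) by simp
    next
      case 2 then show ?thesis
        using ch_own[of ?w] ch_other[of ?w] w
        by (cases "gown st (hd ?w) = Some (gdisc st ?w)") auto
    next
      case 3 then show ?thesis using ch_deep[of ?w] w by auto
    qed
  qed
  then show ?thesis using all_nth[OF assms(1,3)] by linarith
qed

lemma unexplored_prefix:
  assumes "y \<notin> gall st"
    and "\<And>n. \<lbrakk>n < length y; take n y \<in> gall st\<rbrakk> \<Longrightarrow> y ! n < gch st (take n y)"
  shows "\<exists>n \<le> length y. 0 < n \<and> unexplored (take n y)"
proof -
  define n where "n = (LEAST n. take n y \<notin> gall st)"
  have n: "take n y \<notin> gall st" unfolding n_def
    by (rule LeastI[of _ "length y"]) (use assms in simp)
  have le: "n \<le> length y" unfolding n_def by (rule Least_le) (use assms in simp)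
  have pos: "0 < n" using n root by (cases n) auto
  then have "n - 1 < (LEAST n. take n y \<notin> gall st)" by (simp add: n_def)
  then have "take (n - 1) y \<in> gall st" using not_less_Least by blast
  moreover have "take n y = take (n - 1) y @ [y ! (n - 1)]"
    using pos le by (metis Suc_diff_1 Suc_le_lessD take_Suc_conv_app_nth Suc_pred)
  moreover have "y ! (n - 1) < gch st (take (n - 1) y)"
    using assms(2)[of "n - 1"] calculation(1) pos le by auto
  ultimately have "unexplored (take n y)"
    using n unfolding unexplored_def by simp
  then show ?thesis using le pos by blast
qed

text \<open>Completing all \<open>N\<close> branches takes \<open>N * \<sigma>\<close> different
  vertices, more than the agents can discover.\<close>

lemma free_branch:
  assumes big: "k * B + 1 < N * \<sigma>"
  shows "\<exists>p<N. w @ [p] @ replicate (\<sigma> - 1) 0 \<notin> gall st"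
proof (rule ccontr)
  assume "\<not> ?thesis"
  then have all: "w @ [p] @ replicate (\<sigma> - 1) 0 \<in> gall st" if "p < N" for p using that by blast
  define f where "f = (\<lambda>(p, l). w @ [p] @ replicate l (0 :: nat))"
  have "f ` ({..<N} \<times> {..<\<sigma>}) \<subseteq> gall st"
  proof (clarsimp simp: f_def)
    fix p l assume "p < N" "l < \<sigma>"
    then have "min l (\<sigma> - 1) = l" by simp
    then show "w @ p # replicate l 0 \<in> gall st"
      using all_take[OF all[OF \<open>p < N\<close>], of "length w + 1 + l"] by simp
  qed
  moreover have "inj_on f ({..<N} \<times> {..<\<sigma>})"
    by (auto simp: inj_on_def f_def)
  ultimately have "card ({..<N} \<times> {..<\<sigma>}) \<le> card (gall st)"
    using fin by (metis card_image card_mono)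
  then show False using card_all big by (simp add: card_cartesian_product)
qed

lemma unflagged_open:
  assumes big: "k * B + 1 < N * \<sigma>" and i: "i < m" "i \<notin> gfl st"
  shows "\<exists>x. unexplored x \<and> hd x = i \<and> length x \<le> s + \<sigma>"
proof -
  \<comment> \<open>The end of leg \<open>i\<close>: between the root and depth \<open>s\<close>
    only port \<open>0\<close> leads down.\<close>
  define w where "w = i # replicate (s - 1) 0"
  have lw: "length w = s" using s_pos by (simp add: w_def)
  obtain p where p: "p < N" "w @ [p] @ replicate (\<sigma> - 1) 0 \<notin> gall st"
    using free_branch[OF big] by blast
  define y where "y = w @ [p] @ replicate (\<sigma> - 1) 0"
  have ly: "length y = s + \<sigma>" using lw \<sigma>_pos by (simp add: y_def)
  have hdy: "hd y = i" "y \<noteq> []" by (auto simp: y_def w_def)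
  have "y ! n < gch st (take n y)" if n: "n < length y" "take n y \<in> gall st" for n
  proof -
    have hdt: "0 < n \<Longrightarrow> hd (take n y) = i" using hdy hd_take by simp
    have lt: "length (take n y) = n" using n by simp
    consider "n = 0" | "0 < n" "n < s" | "n = s" | "s < n" by linarith
    then show ?thesis
    proof cases
      case 1 then show ?thesis using root i by (simp add: y_def w_def)
    next
      case 2
      then have "y ! n = w ! n" using lw by (simp add: y_def nth_append)
      also have "\<dots> = 0" using 2 by (cases n) (auto simp: w_def)
      finally have "y ! n = 0" .
      then show ?thesis using ch_leg[OF n(2)] 2 lt by fastforce
    next
      case 3
      then have "y ! n = p" using lw by (simp add: y_def nth_append)
      then show ?thesis using ch_u[OF n(2)] 3 lt p by simp
    next
      case 4
      then have "y ! n = 0" using n lw by (simp add: y_def nth_append)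
      moreover have "gch st (take n y) = 1"
        using ch_own[OF n(2)] ch_other[OF n(2)] 4 lt hdt i ly n T_large
        by (cases "gown st (hd (take n y)) = Some (gdisc st (take n y))") auto
      ultimately show ?thesis by simp
    qed
  qed
  then obtain n where "n \<le> length y" "0 < n" "unexplored (take n y)"
    using unexplored_prefix[of y] p y_def by blast
  then show ?thesis using hdy hd_take ly by (intro exI[of _ "take n y"]) auto
qed

text \<open>The same count one stage lower: as long as \<open>g\<close> is not closed, no branch
  below it ends before depth \<open>T + \<sigma>\<close>.\<close>

lemma unflagged_gadget_open:
  assumes big: "k * B + 1 < N * \<sigma>"
    and g: "g \<in> gall st" "length g = T" "gch st g \<noteq> 0" "g \<notin> gtf st"
  shows "\<exists>x. unexplored x \<and> hd x = hd g"
proof -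
  obtain p where p: "p < N" "g @ [p] @ replicate (\<sigma> - 1) 0 \<notin> gall st"
    using free_branch[OF big] by blast
  define y where "y = g @ [p] @ replicate (\<sigma> - 1) 0"
  have ly: "length y = T + \<sigma>" using g \<sigma>_pos by (simp add: y_def)
  have "g \<noteq> []" using g T_large by auto
  then have hdy: "hd y = hd g" by (simp add: y_def)
  have "y ! n < gch st (take n y)" if n: "n < length y" "take n y \<in> gall st" for n
  proof -
    consider "n < T" | "n = T" | "T < n" by linarith
    then show ?thesis
    proof cases
      case 1 then show ?thesis using all_nth[OF g(1), of n] g by (simp add: y_def nth_append)
    next
      case 2 then show ?thesis using gadget_ch[OF g(1-3)] g p by (simp add: y_def nth_append)
    next
      case 3
      then have "y ! n = 0" using n g by (simp add: y_def nth_append)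
      moreover have "take T (take n y) = g" using 3 g by (simp add: y_def min_def)
      ultimately show ?thesis using ch_deep[OF n(2)] 3 n ly g by simp
    qed
  qed
  then obtain n where "n \<le> length y" "0 < n" "unexplored (take n y)"
    using unexplored_prefix[of y] p y_def by blast
  then show ?thesis using hdy hd_take by (intro exI[of _ "take n y"]) auto
qed

lemma dead_flagged: "k * B + 1 < N * \<sigma> \<Longrightarrow> i \<in> dead \<Longrightarrow> i \<in> gfl st"
  using unflagged_open[of i] by (auto simp: dead_def)

text \<open>If no gadget at depth \<open>T\<close> exists in a dead leg, then every branch in it was closed by an
  agent other than the owner, who thus retraced the whole branch.\<close>
lemma dead_retraced:
  assumes i: "i \<in> dead"
    and no: "\<And>g. \<lbrakk>g \<in> gall st; length g = T; hd g = i\<rbrakk> \<Longrightarrow> gch st g = 0"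
    and v: "v \<in> gall st" "s < length v" "hd v = i" "gown st i = Some (gdisc st v)"
  shows "\<exists>b<k. v \<in> retraced b"
proof -
  \<comment> \<open>\<open>w\<close> will be a deepest explored descendant of \<open>v\<close>. It
    has no child: an explored one would be deeper, an unexplored one would contradict that the leg
    is dead.\<close>
  define S where "S = {w \<in> gall st. take (length v) w = v}"
  have "finite S" "v \<in> S" using fin v by (auto simp: S_def)
  define M where "M = Max (length ` S)"
  have "M \<in> length ` S" unfolding M_def using \<open>finite S\<close> \<open>v \<in> S\<close> by (intro Max_in) auto
  then obtain w where w: "w \<in> S" "length w = M" by auto
  have max: "length x \<le> length w" if "x \<in> S" for x
    unfolding w(2) M_def using \<open>finite S\<close> that by (intro Max_ge) auto
  have wall: "w \<in> gall st" and tw: "take (length v) w = v" using w by (auto simp: S_def)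
  have lv: "length v \<le> length w" using max \<open>v \<in> S\<close> by blast
  have "0 < length v" using v(2) by linarith
  then have "hd w = hd (take (length v) w)" using hd_take by metis
  moreover have "length w > 0" using lv \<open>0 < length v\<close> by linarith
  ultimately have hdw: "hd w = i" "w \<noteq> []" using tw v(3) by auto
  have w0: "gch st w = 0"
  proof (rule ccontr)
    assume "gch st w \<noteq> 0"
    then have "w @ [0] \<in> gall st \<or> unexplored (w @ [0])"
      using wall by (auto simp: unexplored_def)
    moreover have "\<not> unexplored (w @ [0])" using i hdw by (auto simp: dead_def)
    ultimately have "w @ [0] \<in> S" using tw lv by (simp add: S_def)
    then show False using max by fastforce
  qed
  have wT: "length w \<le> T"
  proof (rule ccontr)
    assume "\<not> length w \<le> T"
    then have "gch st (take T w) \<noteq> 0" using all_nth[OF wall, of T] by auto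
    moreover have "hd (take T w) = i" using hd_take[of T w] hdw T_large by simp
    ultimately show False using no[of "take T w"] all_take[OF wall] \<open>\<not> length w \<le> T\<close> by simp
  qed
  \<comment> \<open>Down to depth \<open>T\<close> every vertex discovered by the owner has a child,
    so another agent discovered \<open>w\<close>, and it passed \<open>v\<close> on the way.\<close>
  have "gown st i \<noteq> Some (gdisc st w)"
  proof
    assume "gown st i = Some (gdisc st w)"
    then have "gch st w \<noteq> 0" using ch_own[OF wall] wT lv v hdw N_pos by auto
    then show False using w0 by simp
  qed
  then have "gdisc st w \<noteq> gdisc st v" using v by auto
  moreover have "gdisc st w < k" "w \<in> gvis st (gdisc st w)" using disc wall hdw by auto
  moreover have "v \<in> gvis st (gdisc st w)" using vis_take[OF calculation(3), of "length v"] tw by simp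
  ultimately show ?thesis using v unfolding retraced_def by auto
qed

section \<open>What a single agent can find\<close>

lemma ell_unique_own: "gown st i = Some a \<Longrightarrow> gown st j = Some a \<Longrightarrow> i = j"
  by (metis own option.inject)

lemma no_ell:
  assumes "gell st a = None"
  shows "found a = {}" "retraced a = {}"
  using not_disc[OF assms] ell_None[OF assms] by (fastforce simp: found_def retraced_def)+

lemma found_vis: "found a \<subseteq> gvis st a"
  using disc by (fastforce simp: found_def)

text \<open>The three sets are disjoint: \<open>P\<close> lies at depth at most \<open>s\<close>,
  and the other two lie deeper and differ in the discoverer.\<close>

lemma card_found_retraced:
  assumes "P \<subseteq> gvis st a" "\<And>x. x \<in> P \<Longrightarrow> length x \<le> s"
  shows "card P + card (found a) + card (retraced a) \<le> card (gvis st a)"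
proof -
  have "card P + card (found a) + card (retraced a) = card (P \<union> found a \<union> retraced a)"
  proof -
    have "P \<inter> found a = {}" "(P \<union> found a) \<inter> retraced a = {}"
      using assms(2) by (fastforce simp: found_def retraced_def)+
    moreover have "finite P" using assms finite_vis finite_subset by blast
    ultimately show ?thesis by (simp add: card_Un_disjoint finite_found finite_retraced)
  qed
  also have "\<dots> \<le> card (gvis st a)"
    using assms(1) found_vis finite_vis by (intro card_mono) (auto simp: retraced_def)
  finally show ?thesis .
qed

lemma card_prefixes: "n \<le> length x \<Longrightarrow> card ((\<lambda>j. take j x) ` {l..n}) = Suc n - l"
  by (subst card_image) (auto intro!: inj_on_inverseI[of _ length])

text \<open>The root and the \<open>s\<close> vertices of the first leg are visited in addition.
  Then \<open>cost\<close> applies, with a final position at depth at most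
  \<open>T + \<sigma>\<close>.\<close>

lemma one_leg:
  assumes "gell st a = Some i"
  shows "2 * (card (found a) + card (retraced a)) + 2 * s \<le> B + T + \<sigma>"
proof -
  obtain x where x: "x \<in> gvis st a" "length x = s" using ell[OF assms] by blast
  define P where "P = (\<lambda>j. take j x) ` {0..s}"
  have "card P + card (found a) + card (retraced a) \<le> card (gvis st a)"
    by (rule card_found_retraced) (use x vis_take in \<open>auto simp: P_def\<close>)
  moreover have "card P = Suc s" unfolding P_def using card_prefixes[of s x 0] x by simp
  moreover have "length (gpos st a) \<le> T + \<sigma>" using length_le pos vis(1) by blast
  ultimately show ?thesis using cost[of a] used[of a] by simp
qed

text \<open>The second leg adds another \<open>s\<close> visited vertices; \<open>Q\<close> starts
  at depth 1 because \<open>P\<close> contains the root. The final depth is kept in the bound, to be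
  estimated by \<open>deep_retraced\<close> for non-owners.\<close>

lemma two_legs:
  assumes "gell st a = Some i" "\<not> confined st a i"
  shows "2 * (card (found a) + card (retraced a)) + 4 * s \<le> B + length (gpos st a)"
proof -
  obtain x where x: "x \<in> gvis st a" "length x = s" "hd x = i" using ell[OF assms(1)] by blast
  obtain y where y: "y \<in> gvis st a" "s < length y" "hd y \<noteq> i"
    using assms(2) by (auto simp: confined_def)
  define P where "P = (\<lambda>j. take j x) ` {0..s}"
  define Q where "Q = (\<lambda>j. take j y) ` {1..s}"
  have "P \<inter> Q = {}"
  proof -
    have "take j x \<noteq> take l y" if "l \<in> {1..s}" for j l
    proof
      assume eq: "take j x = take l y"
      have "take l y \<noteq> []" using that y by auto
      with eq have "0 < j" by (cases j) auto
      then show False using eq that hd_take[of j x] hd_take[of l y] x y by simp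
    qed
    then show ?thesis by (auto simp: P_def Q_def)
  qed
  then have "card (P \<union> Q) = card P + card Q" by (intro card_Un_disjoint) (auto simp: P_def Q_def)
  moreover have "card P = Suc s" "card Q = s"
    unfolding P_def Q_def using card_prefixes[of s x 0] card_prefixes[of s y 1] x y by auto
  moreover have "card (P \<union> Q) + card (found a) + card (retraced a) \<le> card (gvis st a)"
    by (rule card_found_retraced) (use x y vis_take in \<open>auto simp: P_def Q_def\<close>)
  ultimately show ?thesis using cost[of a] used[of a] by simp
qed

text \<open>A non-owner that is deep in a branch has walked along a path built by the owner.\<close>
lemma deep_retraced:
  assumes "gell st a = Some i" "gown st i \<noteq> Some a"
  shows "length (gpos st a) \<le> s + 2 * \<sigma> + card (retraced a)"
proof -
  define x where "x = gpos st a"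
  have x: "x \<in> gvis st a" "x \<in> gall st" using pos vis(1) x_def by auto
  \<comment> \<open>A proper prefix of \<open>x\<close> has a child on the way to \<open>x\<close>;
    at depths from \<open>s + \<sigma>\<close> to \<open>T\<close> this makes it a vertex of the
    owner. Below depth \<open>T\<close> there are at most \<open>\<sigma>\<close> more
    levels.\<close>
  define U where "U = min (length x - 1) T"
  define P where "P = (\<lambda>j. take j x) ` {s + \<sigma>..U}"
  have "P \<subseteq> retraced a"
  proof
    fix w assume "w \<in> P"
    then obtain j where j: "w = take j x" "s + \<sigma> \<le> j" "j \<le> U" by (auto simp: P_def)
    have jx: "j < length x" using j s_pos by (auto simp: U_def)
    have w: "w \<in> gvis st a" "w \<in> gall st" "length w = j" "hd w = hd x"
      using j jx vis_take[OF x(1)] all_take[OF x(2)] hd_take[of j x] s_pos by auto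
    have "gch st w \<noteq> 0" using all_nth[OF x(2) jx] j by auto
    then have o: "gown st (hd w) = Some (gdisc st w)"
      using gadget_own[OF w(2)] j w by (auto simp: U_def)
    moreover have "gdisc st w \<noteq> a" using own[OF o] assms o by auto
    ultimately show "w \<in> retraced a" using w j \<sigma>_pos by (auto simp: retraced_def)
  qed
  then have "card P \<le> card (retraced a)" by (intro card_mono finite_retraced)
  moreover have "card P = Suc U - (s + \<sigma>)" unfolding P_def
    by (rule card_prefixes) (auto simp: U_def)
  moreover have "length x \<le> T + \<sigma>" using length_le x by blast
  ultimately show ?thesis unfolding x_def[symmetric] U_def by (auto simp: min_def split: if_splits)
qed

text \<open>By \<open>leaf_conf\<close> everything such an agent finds is a leaf, and by
  \<open>nth_zero\<close> a leaf of the leg is determined by its branch at depth \<open>s\<close>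
  and, if it lies below depth \<open>T\<close>, its branch there. The code \<open>0\<close> marks
  leaves that do not lie below depth \<open>T\<close>.\<close>

lemma confined_found:
  assumes a: "gell st a = Some i" "gown st i \<noteq> Some a" "i \<in> gfl st" "confined st a i"
  shows "card (found a) \<le> N + N * N"
proof -
  define f where "f v = (v ! s, if T < length v then v ! T + 1 else 0)" for v :: "nat list"
  have leaf: "gch st v = 0" "hd v = i" "v \<in> gall st" "s < length v" if "v \<in> found a" for v
    using that leaf_conf[OF a] a(4) found_vis by (auto simp: found_def confined_def)
  \<comment> \<open>Equal codes make the shorter address a prefix of the longer one, and a leaf is a
    proper prefix of no explored vertex.\<close>
  have pre: "v = w" if vw: "v \<in> found a" "w \<in> found a" "f v = f w" "length v \<le> length w" for v w
  proof -
    have "v ! n = w ! n" if n: "n < length v" for n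
    proof -
      consider "n = 0" | "n = s" | "n = T" | "0 < n" "n \<noteq> s" "n \<noteq> T" by blast
      then show ?thesis
      proof cases
        case 1 then show ?thesis
          using leaf(2)[OF vw(1)] leaf(2)[OF vw(2)] n vw(4) by (cases v; cases w) auto
      next
        case 2 then show ?thesis using vw(3) by (simp add: f_def)
      next
        case 3 then show ?thesis using vw(3,4) n by (auto simp: f_def)
      next
        case 4 then show ?thesis
          using nth_zero[OF leaf(3)[OF vw(1)]] nth_zero[OF leaf(3)[OF vw(2)]] n vw(4) by simp
      qed
    qed
    then have v: "v = take (length v) w" using vw(4) by (intro nth_equalityI) auto
    have "length v = length w"
    proof (rule ccontr)
      assume "length v \<noteq> length w"
      then have "gch st (take (length v) w) \<noteq> 0"
        using all_nth[OF leaf(3)[OF vw(2)], of "length v"] vw(4) by auto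
      then show False using v leaf(1)[OF vw(1)] by simp
    qed
    then show ?thesis using v by simp
  qed
  have "inj_on f (found a)"
  proof (rule inj_onI)
    fix v w assume "v \<in> found a" "w \<in> found a" "f v = f w"
    then show "v = w" using pre[of v w] pre[of w v] by (cases "length v \<le> length w") auto
  qed
  moreover have "f ` found a \<subseteq> {..<N} \<times> {..N}"
  proof (rule image_subsetI)
    fix v assume v: "v \<in> found a"
    have "v ! s < N" using all_nth[OF leaf(3,4)[OF v]] ch_u[OF all_take[OF leaf(3)[OF v]], of s] leaf(4)[OF v]
      by simp
    moreover have "v ! T < N" if "T < length v"
      using all_nth[OF leaf(3)[OF v] that] gadget_ch[OF all_take[OF leaf(3)[OF v]], of T] that by simp
    ultimately show "f v \<in> {..<N} \<times> {..N}" by (auto simp: f_def less_eq_Suc_le)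
  qed
  ultimately have "card (found a) \<le> card ({..<N} \<times> {..N})"
    by (metis card_image card_mono finite_SigmaI finite_atMost finite_lessThan)
  then show ?thesis by (simp add: card_cartesian_product algebra_simps)
qed

lemma card_legs: "card {v \<in> gall st. length v \<le> s} \<le> 1 + m * s"
proof -
  define g where "g = (\<lambda>v :: nat list. (hd v, length v))"
  let ?S = "{v \<in> gall st. length v \<le> s} - {[]}"
  have "inj_on g ?S"
  proof (rule inj_onI)
    fix v w assume v: "v \<in> ?S" and w: "w \<in> ?S" and "g v = g w"
    then have eq: "hd v = hd w" "length v = length w" by (simp_all add: g_def)
    have "v ! n = w ! n" if n: "n < length v" for n
    proof (cases "n = 0")
      case True then show ?thesis using v w eq by (simp add: hd_conv_nth)
    next
      case False
      then have *: "0 < n" "n < s" "s < T" "n < length w" using n v eq T_large by auto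
      have "v ! n = 0" using nth_zero[of v n] n v * by simp
      moreover have "w ! n = 0" using nth_zero[of w n] w * by simp
      ultimately show ?thesis by simp
    qed
    with eq(2) show "v = w" by (rule nth_equalityI)
  qed
  moreover have "g ` ?S \<subseteq> {..<m} \<times> {1..s}"
  proof (rule image_subsetI)
    fix v assume v: "v \<in> ?S"
    then have "hd v < m" using hd_less by blast
    moreover have "1 \<le> length v" using v by (cases v) auto
    ultimately show "g v \<in> {..<m} \<times> {1..s}" using v by (simp add: g_def)
  qed
  ultimately have "card ?S \<le> card ({..<m} \<times> {1..s})"
    by (rule card_inj_on_le) simp
  then have "card ?S \<le> m * s" by (simp add: card_cartesian_product)
  moreover have "card {v \<in> gall st. length v \<le> s} \<le> card ?S + 1"
    using fin root by (simp add: card_Diff_singleton)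
  ultimately show ?thesis by simp
qed

section \<open>Counting all explored vertices\<close>

definition owners :: "nat set" where
  "owners = {a. a < k \<and> (\<exists>i. gown st i = Some a)}"

text \<open>By \<open>exempt\<close> the first leg of these agents is the only unflagged one. As
  \<open>leaf_conf\<close> does not cover them, they are counted like owners.\<close>

definition exempted :: "nat set" where
  "exempted = {a. a < k \<and> (\<exists>i. gell st a = Some i \<and> gown st i \<noteq> Some a \<and> i \<notin> gfl st)}"

lemma ell_less: "gell st a = Some i \<Longrightarrow> i < m" "gell st a = Some i \<Longrightarrow> a < k"
  using ell[of a i] by simp_all

lemma not_owner:
  assumes "gell st a = Some i" "gown st i \<noteq> Some a"
  shows "a \<notin> owners"
proof
  assume "a \<in> owners"
  then obtain j where j: "gown st j = Some a" by (auto simp: owners_def)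
  from own[OF j] j assms show False by simp
qed

lemma not_exempted:
  assumes "gell st a = Some i" "i \<in> gfl st"
  shows "a \<notin> exempted"
  using assms by (simp add: exempted_def)

text \<open>There is at most one owner per leg. If an exempted agent exists, each of the other
  \<open>m - 1\<close> legs is flagged and so has its own agent that is neither owner nor exempted,
  which leaves \<open>2 * m - (m - 1)\<close> agents.\<close>

lemma card_owners_exempted:
  assumes "k = 2 * m"
  shows "card (owners \<union> exempted) \<le> m + 1"
proof (cases "exempted = {}")
  case True
  have "owners \<subseteq> (\<lambda>i. the (gown st i)) ` {..<m}"
  proof
    fix a assume "a \<in> owners"
    then obtain i where i: "gown st i = Some a" by (auto simp: owners_def)
    then have "i < m" using ell_less(1)[OF own] by simp
    then show "a \<in> (\<lambda>i. the (gown st i)) ` {..<m}" using i by (intro image_eqI[of _ _ i]) simp_all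
  qed
  then have "card owners \<le> card {..<m}" by (rule surj_card_le[rotated]) simp
  then show ?thesis using True by simp
next
  case False
  then obtain a i where a: "gell st a = Some i" "gown st i \<noteq> Some a" "i \<notin> gfl st"
    by (auto simp: exempted_def)
  then have i: "i < m" using ell_less(1) by simp
  have "\<forall>j \<in> {..<m} - {i}. \<exists>b. gell st b = Some j \<and> gown st j \<noteq> Some b \<and> j \<in> gfl st"
  proof
    fix j assume "j \<in> {..<m} - {i}"
    then have "j \<in> gfl st" using exempt[OF a, of j] by simp
    then show "\<exists>b. gell st b = Some j \<and> gown st j \<noteq> Some b \<and> j \<in> gfl st"
      using fl_ex[of j] by simp
  qed
  from bchoice[OF this] obtain b where b: "\<And>j. j \<in> {..<m} - {i} \<Longrightarrow>
      gell st (b j) = Some j \<and> gown st j \<noteq> Some (b j) \<and> j \<in> gfl st"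
    by auto
  have "inj_on b ({..<m} - {i})"
  proof (rule inj_onI)
    fix x y assume "x \<in> {..<m} - {i}" "y \<in> {..<m} - {i}" "b x = b y"
    then show "x = y" using b[of x] b[of y] by (metis option.inject)
  qed
  then have card_b: "card (b ` ({..<m} - {i})) = m - 1" using i by (simp add: card_image)
  have sub: "b ` ({..<m} - {i}) \<subseteq> {..<k} - (owners \<union> exempted)"
  proof (rule image_subsetI)
    fix j assume j: "j \<in> {..<m} - {i}"
    have "b j < k" using b[OF j] ell_less(2) by simp
    moreover have "b j \<notin> owners" using b[OF j] by (intro not_owner[of _ j]) simp_all
    moreover have "b j \<notin> exempted" using b[OF j] by (intro not_exempted[of _ j]) simp_all
    ultimately show "b j \<in> {..<k} - (owners \<union> exempted)" by simp
  qed
  have R: "owners \<union> exempted \<subseteq> {..<k}" by (auto simp: owners_def exempted_def)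
  have "m - 1 \<le> card ({..<k} - (owners \<union> exempted))"
    unfolding card_b[symmetric] using sub by (rule card_mono[rotated]) simp
  also have "\<dots> = k - card (owners \<union> exempted)"
    using card_Diff_subset[OF finite_subset[OF R] R] by simp
  finally show ?thesis using card_mono[OF _ R] assms i by simp
qed

text \<open>An agent that is neither an owner nor exempt is charged \<open>\<kappa>\<close> for every retraced vertex; the
  charges pay for the dead legs in which no gadget at depth \<open>T\<close> was ever reached.\<close>
lemma card_all_le:
  fixes \<Omega> \<eta> \<epsilon> :: real
  assumes k: "k = 2 * m" and big: "k * B + 1 < N * \<sigma>"
    and \<Omega>: "\<Omega> = (real B + real T + real \<sigma>) / 2 - real s"
    and \<eta>: "\<eta> = (real B - 3 * real s) / 2"
    and \<epsilon>: "\<epsilon> = real N + real N * real N + real \<sigma>"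
    and cond: "0 \<le> \<eta>" "\<eta> \<le> real s" "2 * \<eta> \<le> \<Omega>" "\<eta> + \<epsilon> \<le> \<Omega>" "0 < \<Omega>"
  shows "real (card (gall st)) \<le>
     1 + real m * real s + (real m + 1) * \<Omega> + (real m - 1) * (\<eta> + \<epsilon>) - real (card dead) * \<eta>"
proof -
  \<comment> \<open>Chosen so that retracing \<open>\<Omega>\<close> vertices, the most that fits
    into the budget, is charged \<open>\<eta>\<close>.\<close>
  define \<kappa> where "\<kappa> = \<eta> / \<Omega>"
  have \<kappa>: "0 \<le> \<kappa>" "\<kappa> \<le> 1 / 2" "\<kappa> * \<Omega> = \<eta>" using cond by (simp_all add: \<kappa>_def field_simps)
  define R where "R = owners \<union> exempted"
  define f where "f a = real (card (found a))" for a
  define r where "r a = real (card (retraced a))" for a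
  define W where "W a = f a + \<kappa> * r a" for a
  have f0: "0 \<le> f a" and r0: "0 \<le> r a" for a by (simp_all add: f_def r_def)
  have \<epsilon>0: "0 \<le> \<epsilon>" by (simp add: \<epsilon>)
  have RA: "R \<subseteq> {..<k}" by (auto simp: R_def owners_def exempted_def)
  then have finR: "finite R" by (rule finite_subset) simp
  have leg1: "f a + r a \<le> \<Omega>" if "gell st a = Some i" for a i
    using one_leg[OF that, THEN of_nat_mono[where 'a=real]] unfolding \<Omega> f_def r_def
    by (simp only: of_nat_add of_nat_mult of_nat_numeral) argo
  have \<kappa>r: "\<kappa> * r a \<le> r a / 2" for a
    using mult_right_mono[OF \<kappa>(2) r0[of a]] by simp
  have W_R: "W a \<le> \<Omega>" if aR: "a \<in> R" for a
  proof -
    obtain i where "gell st a = Some i"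
      using aR own[of _ a] by (auto simp: R_def owners_def exempted_def)
    then show ?thesis using leg1[of a i] \<kappa>r[of a] r0[of a] by (simp add: W_def)
  qed
  have W_nR: "W a \<le> \<eta> + \<epsilon>" if "a < k" "a \<notin> R" for a
  proof (cases "gell st a")
    case None
    then show ?thesis using no_ell[of a] cond \<epsilon>0 by (simp add: W_def f_def r_def)
  next
    case (Some i)
    then have o: "gown st i \<noteq> Some a" "i \<in> gfl st"
      using that by (auto simp: R_def owners_def exempted_def)
    show ?thesis
    proof (cases "confined st a i")
      case True
      have "f a \<le> real N + real N * real N"
        using confined_found[OF Some o True] unfolding f_def
        unfolding of_nat_mult[symmetric] of_nat_add[symmetric] of_nat_le_iff .
      moreover have "\<kappa> * r a \<le> \<kappa> * \<Omega>"
        using leg1[OF Some] f0[of a] \<kappa>(1) by (intro mult_left_mono) auto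
      ultimately show ?thesis using \<kappa>(3) by (simp add: W_def \<epsilon>)
    next
      case False
      \<comment> \<open>With \<open>deep_retraced\<close> for the final depth,
        \<open>two_legs\<close> still leaves half a unit per retraced vertex, which covers the
        charge as \<open>\<kappa> \<le> 1 / 2\<close>.\<close>
      have "2 * f a + r a \<le> real B - 3 * real s + 2 * real \<sigma>"
        using two_legs[OF Some False, THEN of_nat_mono[where 'a=real]]
          deep_retraced[OF Some o(1), THEN of_nat_mono[where 'a=real]]
        unfolding f_def r_def by (simp only: of_nat_add of_nat_mult of_nat_numeral) argo
      then show ?thesis using \<kappa>r[of a] unfolding W_def \<eta> \<epsilon>
        using zero_le_square[of "real N"] of_nat_0_le_iff[of N, where 'a=real] by argo
    qed
  qed
  \<comment> \<open>In a dead leg of \<open>D1\<close> there is a gadget, which must have been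
    closed; so \<open>tf_ex\<close> yields a confined agent, and it finds at most
    \<open>\<epsilon>\<close>. In a leg of \<open>D2\<close> all vertices of the owner below the leg
    end were retraced, and the charges compensate.\<close>
  define D1 where "D1 = {i \<in> dead. \<exists>g \<in> gall st. length g = T \<and> hd g = i \<and> gch st g \<noteq> 0}"
  define D2 where "D2 = dead - D1"
  have fin_dead: "finite dead" by (simp add: dead_def)
  then have fin12: "finite D1" "finite D2" by (auto simp: D1_def D2_def)
  have card12: "card D1 + card D2 = card dead"
    using fin_dead by (auto simp: D2_def D1_def card_Diff_subset card_mono)
  have dfl: "i \<in> gfl st" if "i \<in> dead" for i using dead_flagged[OF big that] .
  have "\<forall>i \<in> D1. \<exists>a. gell st a = Some i \<and> gown st i \<noteq> Some a \<and> confined st a i"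
  proof
    fix i assume "i \<in> D1"
    then obtain g where g: "i \<in> dead" "g \<in> gall st" "length g = T" "hd g = i" "gch st g \<noteq> 0"
      by (auto simp: D1_def)
    then have "g \<in> gtf st" using unflagged_gadget_open[OF big g(2,3,5)] by (auto simp: dead_def)
    then show "\<exists>a. gell st a = Some i \<and> gown st i \<noteq> Some a \<and> confined st a i"
      using tf_ex[of g] g(4) by auto
  qed
  from bchoice[OF this] obtain c where c: "\<And>i. i \<in> D1 \<Longrightarrow> gell st (c i) = Some i"
    "\<And>i. i \<in> D1 \<Longrightarrow> gown st i \<noteq> Some (c i)" "\<And>i. i \<in> D1 \<Longrightarrow> confined st (c i) i"
    by auto
  define C where "C = c ` D1"
  have "inj_on c D1"
  proof (rule inj_onI)
    fix x y assume "x \<in> D1" "y \<in> D1" "c x = c y"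
    then show "x = y" using c(1)[of x] c(1)[of y] by (metis option.inject)
  qed
  then have cardC: "card C = card D1" by (simp add: C_def card_image)
  have CA: "C \<subseteq> {..<k}" using ell_less(2)[OF c(1)] by (auto simp: C_def)
  have finC: "finite C" using fin12 by (simp add: C_def)
  have CR: "C \<inter> R = {}"
  proof -
    have "c i \<notin> R" if i: "i \<in> D1" for i
    proof -
      have "c i \<notin> owners" using c(1,2)[OF i] by (rule not_owner)
      moreover have "c i \<notin> exempted"
        using c(1)[OF i] dfl[of i] i by (intro not_exempted) (simp_all add: D1_def)
      ultimately show ?thesis by (simp add: R_def)
    qed
    then show ?thesis by (auto simp: C_def)
  qed
  have fC: "f a \<le> \<epsilon>" if aC: "a \<in> C" for a
  proof -
    obtain i where i: "i \<in> D1" "a = c i" using aC by (auto simp: C_def)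
    have "card (found a) \<le> N + N * N"
      using confined_found[OF c(1,2)[OF i(1)] _ c(3)[OF i(1)]] dfl i by (auto simp: D1_def)
    then have "f a \<le> real N + real N * real N"
      unfolding f_def of_nat_mult[symmetric] of_nat_add[symmetric] of_nat_le_iff .
    then show ?thesis by (simp add: \<epsilon>)
  qed
  define ow where "ow i = the (gown st i)" for i
  have ow: "gown st i = Some (ow i)" if "i \<in> dead" for i
    using fl_ex[OF dfl[OF that]] own_ex[of _ i] unfolding ow_def by fastforce
  have oi: "inj_on ow D2"
  proof (rule inj_onI)
    fix x y assume "x \<in> D2" "y \<in> D2" "ow x = ow y"
    then show "x = y" using ow[of x] ow[of y] ell_unique_own[of x "ow x" y]
      unfolding D2_def by (metis DiffD1)
  qed
  define F where "F = ow ` D2"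
  have FR: "F \<subseteq> R"
  proof -
    have "ow i \<in> owners" if "i \<in> D2" for i
      using ow[of i] that ell_less(2)[OF own, of i "ow i"] by (auto simp: owners_def D2_def)
    then show ?thesis by (auto simp: F_def R_def)
  qed
  define X where "X i = {v \<in> gall st. s < length v \<and> hd v = i \<and> gown st i = Some (gdisc st v)}" for i
  have finX: "finite (X i)" for i using fin by (simp add: X_def)
  define x where "x i = real (card (X i))" for i
  \<comment> \<open>Charges worth \<open>\<kappa> * x i\<close> are credited to leg
    \<open>i\<close>. A confined owner finds at most \<open>x i\<close> vertices and retraces none;
    any other owner loses \<open>s\<close>, which is at least \<open>\<eta>\<close>, to its second
    leg.\<close>
  have F_bound: "W (ow i) - \<kappa> * x i \<le> \<Omega> - \<eta>" if i: "i \<in> D2" for i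
  proof -
    have oi: "gown st i = Some (ow i)" "gell st (ow i) = Some i"
      using ow[of i] own[of i "ow i"] i by (simp_all add: D2_def)
    have x0: "0 \<le> \<kappa> * x i" using \<kappa> by (simp add: x_def)
    show ?thesis
    proof (cases "confined st (ow i) i")
      case True
      have "retraced (ow i) = {}" using True oi by (auto simp: retraced_def confined_def)
      moreover have "found (ow i) \<subseteq> X i"
        using True oi found_vis[of "ow i"] by (auto simp: found_def X_def confined_def)
      then have fx: "f (ow i) \<le> x i" unfolding f_def x_def using finX by (simp add: card_mono)
      moreover have "\<kappa> * f (ow i) \<le> \<kappa> * x i" using fx \<kappa>(1) by (rule mult_left_mono)
      moreover have "(1 - \<kappa>) * f (ow i) \<le> (1 - \<kappa>) * \<Omega>"
        using leg1[OF oi(2)] r0[of "ow i"] \<kappa>(2) by (intro mult_left_mono) auto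
      ultimately show ?thesis using \<kappa>(3) by (simp add: W_def r_def algebra_simps)
    next
      case False
      have "length (gpos st (ow i)) \<le> T + \<sigma>"
        using length_le[OF subsetD[OF vis(1) pos]] .
      then have "2 * (card (found (ow i)) + card (retraced (ow i))) + 4 * s \<le> B + (T + \<sigma>)"
        using two_legs[OF oi(2) False] by linarith
      then have "f (ow i) + r (ow i) \<le> \<Omega> - real s"
        unfolding \<Omega> f_def r_def
        by (drule_tac of_nat_mono[where 'a=real])
          (simp only: of_nat_add of_nat_mult of_nat_numeral, argo)
      then show ?thesis using \<kappa>r[of "ow i"] r0[of "ow i"] x0 cond(2) by (simp add: W_def)
    qed
  qed
  define A where "A = {..<k} - C"
  \<comment> \<open>By \<open>dead_retraced\<close> every vertex of \<open>X i\<close> was retraced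
    by somebody, and not by an agent of \<open>C\<close>, since these are confined to legs of
    \<open>D1\<close>.\<close>
  have sum_x: "(\<Sum>i\<in>D2. x i) \<le> (\<Sum>a\<in>A. r a)"
  proof -
    have "(\<Union>i\<in>D2. X i) \<subseteq> (\<Union>a\<in>A. retraced a)"
    proof
      fix v assume "v \<in> (\<Union>i\<in>D2. X i)"
      then obtain i where i: "i \<in> D2" and v: "v \<in> gall st" "s < length v" "hd v = i"
        "gown st i = Some (gdisc st v)" by (auto simp: X_def)
      have "gch st g = 0" if "g \<in> gall st" "length g = T" "hd g = i" for g
        using i that by (auto simp: D2_def D1_def)
      then obtain b where b: "b < k" "v \<in> retraced b"
        using dead_retraced[of i v] i v by (auto simp: D2_def)
      have "b \<notin> C"
      proof
        assume "b \<in> C"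
        then obtain j where "j \<in> D1" "b = c j" by (auto simp: C_def)
        then have "hd v = j" using c(3)[of j] b v by (auto simp: confined_def retraced_def)
        then show False using i v \<open>j \<in> D1\<close> by (auto simp: D2_def)
      qed
      then show "v \<in> (\<Union>a\<in>A. retraced a)" using b by (auto simp: A_def)
    qed
    then have "card (\<Union>i\<in>D2. X i) \<le> card (\<Union>a\<in>A. retraced a)"
      by (intro card_mono) (auto simp: A_def finite_retraced)
    also have "\<dots> \<le> (\<Sum>a\<in>A. card (retraced a))" by (rule card_UN_le) (simp add: A_def)
    finally have "card (\<Union>i\<in>D2. X i) \<le> (\<Sum>a\<in>A. card (retraced a))" .
    moreover have "card (\<Union>i\<in>D2. X i) = (\<Sum>i\<in>D2. card (X i))"
      by (rule card_UN_disjoint) (use fin12 finX in \<open>auto simp: X_def\<close>)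
    ultimately have "real (\<Sum>i\<in>D2. card (X i)) \<le> real (\<Sum>a\<in>A. card (retraced a))" by linarith
    then show ?thesis by (simp add: x_def r_def)
  qed
  \<comment> \<open>The agents split into \<open>C\<close>, the owners \<open>F\<close> of the legs
    in \<open>D2\<close>, the rest of \<open>R\<close>, and all others.\<close>
  have "(\<Sum>a<k. f a) = (\<Sum>a\<in>A. f a) + (\<Sum>a\<in>C. f a)"
    unfolding A_def by (rule sum.subset_diff[OF CA]) simp
  moreover have "(\<Sum>a\<in>C. f a) \<le> real (card D1) * \<epsilon>"
    using sum_bounded_above[of C f \<epsilon>] fC cardC by simp
  moreover have "(\<Sum>a\<in>A. W a) = (\<Sum>a\<in>A. f a) + \<kappa> * (\<Sum>a\<in>A. r a)"
    by (simp add: W_def sum.distrib sum_distrib_left)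
  moreover have "\<kappa> * (\<Sum>i\<in>D2. x i) \<le> \<kappa> * (\<Sum>a\<in>A. r a)"
    using sum_x \<kappa>(1) by (rule mult_left_mono)
  moreover have "(\<Sum>a\<in>A. W a) = (\<Sum>a\<in>A - R. W a) + (\<Sum>a\<in>R. W a)"
    using RA CR by (intro sum.subset_diff) (auto simp: A_def)
  moreover have "(\<Sum>a\<in>R. W a) = (\<Sum>a\<in>R - F. W a) + (\<Sum>a\<in>F. W a)"
    using FR finR by (intro sum.subset_diff)
  moreover have "(\<Sum>a\<in>F. W a) = (\<Sum>i\<in>D2. W (ow i))"
    using oi by (simp add: F_def sum.reindex)
  moreover have "(\<Sum>a\<in>A - R. W a) \<le> real (card (A - R)) * (\<eta> + \<epsilon>)"
    by (rule sum_bounded_above) (use W_nR in \<open>simp add: A_def\<close>)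
  moreover have "(\<Sum>a\<in>R - F. W a) \<le> real (card (R - F)) * \<Omega>"
    by (rule sum_bounded_above) (use W_R in simp)
  ultimately have "(\<Sum>a<k. f a) \<le> real (card D1) * \<epsilon> + (real (card (A - R)) * (\<eta> + \<epsilon>) +
      (real (card (R - F)) * \<Omega> + (\<Sum>i\<in>D2. W (ow i))) - \<kappa> * (\<Sum>i\<in>D2. x i))" by linarith
  moreover have "(\<Sum>i\<in>D2. W (ow i)) - \<kappa> * (\<Sum>i\<in>D2. x i) \<le> real (card D2) * (\<Omega> - \<eta>)"
    using sum_bounded_above[of D2 "\<lambda>i. W (ow i) - \<kappa> * x i" "\<Omega> - \<eta>"] F_bound
    by (simp add: sum_subtractf sum_distrib_left)
  moreover have "real (card (R - F)) = real (card R) - real (card D2)"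
  proof -
    have "card F = card D2" using oi by (simp add: F_def card_image)
    moreover have "card F \<le> card R" using finR FR by (rule card_mono)
    ultimately show ?thesis using card_Diff_subset[OF finite_subset[OF FR finR] FR] by simp
  qed
  moreover have "real (card (A - R)) = 2 * real m - real (card D1) - real (card R)"
  proof -
    have "A - R = {..<k} - (C \<union> R)" by (auto simp: A_def)
    moreover have "card (C \<union> R) = card D1 + card R"
      using CR finC finR cardC by (simp add: card_Un_disjoint)
    moreover have "card (C \<union> R) \<le> card {..<k}" using CA RA by (intro card_mono) auto
    moreover have "card ({..<k} - (C \<union> R)) = card {..<k} - card (C \<union> R)"
      using CA RA finC finR by (intro card_Diff_subset) auto
    ultimately show ?thesis using k by simp
  qed
  \<comment> \<open>By \<open>cond\<close> the bound for a member of \<open>R\<close> is at least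
    that for another agent, so the largest possible \<open>R\<close> is the worst case.\<close>
  moreover have "real (card R) * (\<Omega> - (\<eta> + \<epsilon>)) \<le> (real m + 1) * (\<Omega> - (\<eta> + \<epsilon>))"
  proof -
    have "real (card R) \<le> real m + 1" using card_owners_exempted[OF k] unfolding R_def by linarith
    then show ?thesis using cond(4) by (intro mult_right_mono) auto
  qed
  moreover have "real (card dead) * \<eta> = real (card D1) * \<eta> + real (card D2) * \<eta>"
    unfolding card12[symmetric] by (simp add: distrib_right)
  ultimately have sum_f: "(\<Sum>a<k. f a) \<le>
      (real m + 1) * \<Omega> + (real m - 1) * (\<eta> + \<epsilon>) - real (card dead) * \<eta>"
    by (simp add: algebra_simps)
  have "gall st \<subseteq> {v \<in> gall st. length v \<le> s} \<union> (\<Union>a<k. found a)"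
    using disc by (fastforce simp: found_def)
  then have "card (gall st) \<le> card ({v \<in> gall st. length v \<le> s} \<union> (\<Union>a<k. found a))"
    using fin by (intro card_mono) (auto simp: finite_found)
  also have "\<dots> \<le> card {v \<in> gall st. length v \<le> s} + card (\<Union>a<k. found a)" by (rule card_Un_le)
  also have "card (\<Union>a<k. found a) \<le> (\<Sum>a<k. card (found a))" by (rule card_UN_le) simp
  finally have "card (gall st) \<le> 1 + m * s + (\<Sum>a<k. card (found a))" using card_legs by simp
  then have "real (card (gall st)) \<le> real (1 + m * s + (\<Sum>a<k. card (found a)))" by linarith
  then show ?thesis using sum_f by (simp add: f_def)
qed

section \<open>An offline strategy on the completed tree\<close>

lemma length_unexplored: "unexplored x \<Longrightarrow> length x \<le> T + \<sigma> + 1"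
  using length_le[of "butlast x"] by (simp add: unexplored_def)

lemma unexplored_extension:
  assumes x: "unexplored x" and c: "c < k"
  shows "length x + n < H \<Longrightarrow> x @ c # replicate n 0 \<in> addresses (completion st H)"
proof (induction n)
  case 0
  have sub: "gall st \<subseteq> addresses (completion st H)"
    by (rule in_addresses) (simp_all add: game_inv_axioms completion_def)
  have ch: "completion st H (butlast x) = gch st (butlast x)" "completion st H x = k"
    using x by (simp_all add: unexplored_def completion_def)
  have "butlast x @ [last x] = x" using x by (simp add: unexplored_def)
  moreover have "butlast x @ [last x] \<in> addresses (completion st H)"
    unfolding snoc_in_addresses ch using x sub by (auto simp: unexplored_def)
  ultimately have "x \<in> addresses (completion st H)" by (simp only:)
  then show ?case using c by (simp add: ch)
next
  case (Suc n)
  let ?y = "x @ c # replicate n 0"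
  have no: "z \<notin> gall st" if "take (length x) z = x" for z
    using all_take[of z "length x"] that x by (auto simp: unexplored_def)
  have "?y \<notin> gall st" "butlast ?y \<notin> gall st"
    by (rule no, simp, rule no) (simp add: butlast_append take_butlast)
  then have "0 < completion st H ?y" using Suc.prems by (simp add: completion_def)
  then have "?y @ [0] \<in> addresses (completion st H)"
    unfolding snoc_in_addresses using Suc by simp
  moreover have "x @ c # replicate (Suc n) 0 = ?y @ [0]" by (simp add: replicate_append_same)
  ultimately show ?case by (simp only:)
qed

text \<open>Agent \<open>a\<close> goes to leg \<open>a\<close> if this leg exists, is not dead and
  differs from the chosen unflagged leg \<open>j\<close>; all others go to leg \<open>j\<close>.
  Everybody walks straight down, and in leg \<open>j\<close> only vertices behind \<open>x0\<close>
  are counted, so that none counts twice.\<close>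

lemma opt_completion_ge:
  assumes k: "k = 2 * m" and big: "k * B + 1 < N * \<sigma>" and B_large: "T + \<sigma> + 1 < B"
  shows "card dead < m"
    and "(real m - 1 - real (card dead)) * real B
       + (real m + 1 + real (card dead)) * (real B - real s - real \<sigma>)
     \<le> real (opt_value (tree_inst (completion st B) k B))"
proof -
  obtain j where j: "j < m" "j \<notin> gfl st" using fl by blast
  obtain x0 where x0: "unexplored x0" "hd x0 = j" "length x0 \<le> s + \<sigma>"
    using unflagged_open[OF big j] by blast
  have deadm: "dead \<subseteq> {..<m} - {j}" using dead_flagged[OF big] j by (auto simp: dead_def)
  define L where "L = {..<m} - {j} - dead"
  have "card L = card ({..<m} - {j}) - card dead"
    unfolding L_def using deadm finite_subset[OF deadm] by (intro card_Diff_subset) simp_all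
  moreover have "card dead \<le> m - 1" using card_mono[OF _ deadm] j by simp
  ultimately have cardL: "card L + card dead + 1 = m" using j by simp
  then show "card dead < m" by simp
  have Lk: "L \<subseteq> {..<k}" using k by (auto simp: L_def)
  have "\<forall>i \<in> L. \<exists>x. unexplored x \<and> hd x = i" by (auto simp: L_def dead_def)
  from bchoice[OF this] obtain x where x: "\<And>i. i \<in> L \<Longrightarrow> unexplored (x i) \<and> hd (x i) = i" by auto
  define y where "y a = (if a \<in> L then x a else x0)" for a
  have y: "unexplored (y a)" "hd (y a) = (if a \<in> L then a else j)" for a
    using x x0 by (simp_all add: y_def)
  have y_len: "length (y a) < B" for a using length_unexplored[OF y(1)[of a]] B_large by linarith
  define pth where "pth a = y a @ a # replicate (B - length (y a) - 1) 0" for a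
  have len: "length (pth a) = B" for a using y_len[of a] by (simp add: pth_def)
  have pth: "pth a \<in> addresses (completion st B) \<and> length (pth a) \<le> B" if "a < k" for a
    using unexplored_extension[OF y(1) that, of a] y_len[of a] len[of a] by (simp add: pth_def)
  define lo where "lo a = (if a \<in> L then 0 else length x0)" for a
  define S where "S a = (\<lambda>n. take n (pth a)) ` {Suc (lo a)..B}" for a
  \<comment> \<open>The agent can be read off a counted vertex: from the leg if it is in
    \<open>L\<close>, otherwise from the branch taken right behind \<open>x0\<close>.\<close>
  define key where "key v = (if hd v \<in> L then hd v else v ! length x0)" for v
  have key: "key v = a" if v: "v \<in> S a" for v a
  proof -
    obtain n where n: "v = take n (pth a)" "lo a < n" "n \<le> B" using v by (auto simp: S_def)
    have "y a \<noteq> []" using y(1) by (simp add: unexplored_def)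
    then have "hd v = hd (y a)" using n by (simp add: pth_def hd_take)
    moreover have "v ! length x0 = a" if "a \<notin> L"
      using n that by (simp add: lo_def pth_def y_def nth_append)
    ultimately show ?thesis using y(2)[of a] by (auto simp: key_def L_def)
  qed
  have card_S: "card (S a) = B - lo a" for a
    unfolding S_def using card_prefixes[of B "pth a" "Suc (lo a)"] len by simp
  have "k - card L = m + 1 + card dead" using k cardL by linarith
  then have kL: "real m + 1 + real (card dead) = real (k - card L)" by simp
  have mL: "real m - 1 - real (card dead) = real (card L)" using cardL by linarith
  have "(\<Union>a<k. S a) \<subseteq> (\<Union>a<k. (\<lambda>j. take j (pth a)) ` {..length (pth a)})"
    by (auto simp: S_def len)
  then have "card (\<Union>a<k. S a) \<le> card (\<Union>a<k. (\<lambda>j. take j (pth a)) ` {..length (pth a)})"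
    by (rule card_mono[rotated]) simp
  also have "\<dots> \<le> opt_value (tree_inst (completion st B) k B)"
    using finite_completion pth by (rule opt_value_tree_inst_ge)
  also have "card (\<Union>a<k. S a) = (\<Sum>a<k. card (S a))"
  proof (rule card_UN_disjoint)
    show "\<forall>a\<in>{..<k}. \<forall>b\<in>{..<k}. a \<noteq> b \<longrightarrow> S a \<inter> S b = {}" using key by blast
  qed (simp_all add: S_def)
  finally have "real (\<Sum>a<k. card (S a)) \<le> real (opt_value (tree_inst (completion st B) k B))"
    by (simp only: of_nat_le_iff)
  also have "real (\<Sum>a<k. card (S a)) =
      real (card L) * real B + real (k - card L) * (real B - real (length x0))"
  proof -
    have "real (\<Sum>a<k. card (S a)) = (\<Sum>a<k. real (card (S a)))" by simp
    also have "\<dots> = (\<Sum>a\<in>{..<k} - L. real (card (S a))) + (\<Sum>a\<in>L. real (card (S a)))"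
      using Lk by (intro sum.subset_diff) simp_all
    also have "(\<Sum>a\<in>L. real (card (S a))) = real (card L) * real B"
      by (simp add: card_S lo_def)
    also have "(\<Sum>a\<in>{..<k} - L. real (card (S a))) =
        (\<Sum>a\<in>{..<k} - L. real B - real (length x0))"
      using length_unexplored[OF x0(1)] B_large
      by (intro sum.cong) (auto simp: card_S lo_def of_nat_diff)
    also have "\<dots> = real (k - card L) * (real B - real (length x0))"
      using card_Diff_subset[OF finite_subset[OF Lk] Lk] by simp
    finally show ?thesis by simp
  qed
  finally have "real (card L) * real B + real (k - card L) * (real B - real (length x0))
      \<le> real (opt_value (tree_inst (completion st B) k B))" .
  moreover have "real (k - card L) * (real B - real s - real \<sigma>)
      \<le> real (k - card L) * (real B - real (length x0))"
    using x0(3)[THEN of_nat_mono[where 'a = real]] by (intro mult_left_mono) simp_all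
  ultimately show "(real m - 1 - real (card dead)) * real B
       + (real m + 1 + real (card dead)) * (real B - real s - real \<sigma>)
     \<le> real (opt_value (tree_inst (completion st B) k B))" unfolding kL mL by linarith
qed

end

section \<open>The competitive ratio and its limit\<close>

lemma (in adversary) competitive_bound:
  fixes \<Omega> \<eta> \<epsilon> :: real
  assumes comp: "competitive \<rho> A"
    and k: "k = 2 * m" and big: "k * B + 1 < N * \<sigma>" and B_large: "T + \<sigma> + 1 < B"
    and \<Omega>: "\<Omega> = (real B + real T + real \<sigma>) / 2 - real s"
    and \<eta>: "\<eta> = (real B - 3 * real s) / 2"
    and \<epsilon>: "\<epsilon> = real N + real N * real N + real \<sigma>"
    and cond: "0 \<le> \<eta>" "\<eta> \<le> real s" "2 * \<eta> \<le> \<Omega>" "\<eta> + \<epsilon> \<le> \<Omega>" "0 < \<Omega>"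
  shows "\<exists>q. 0 \<le> q \<and> q \<le> real m - 1 \<and>
    (real m - 1 - q) * real B + (real m + 1 + q) * (real B - real s - real \<sigma>)
    \<le> \<rho> * (1 + real m * real s + (real m + 1) * \<Omega> + (real m - 1) * (\<eta> + \<epsilon>) - q * \<eta>)"
proof -
  obtain M where M: "gstep A (grun A M) = grun A M" using grun_stabilizes by blast
  define st where "st = grun A M"
  interpret G: game_inv m k s T \<sigma> N B st unfolding st_def by (rule grun_inv)
  define I where "I = tree_inst (completion st B) k B"
  \<comment> \<open>The number of dead legs is all that the final bound retains of the run.\<close>
  define q where "q = real (card G.dead)"
  have "1 \<le> k" using k m_pos by simp
  then have "valid_inst I" unfolding I_def using G.finite_completion by (rule valid_tree_inst[rotated])
  then have "ereal (real (opt_value I) / real (alg_value A I)) \<le>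
      (SUP I \<in> {I. valid_inst I}. ereal (real (opt_value I) / real (alg_value A I)))"
    by (intro SUP_upper) simp
  also have "\<dots> \<le> ereal \<rho>" using comp by (simp add: competitive_def)
  finally have ratio: "real (opt_value I) / real (alg_value A I) \<le> \<rho>" by simp
  have alg: "alg_value A I = card (gall st)"
    unfolding I_def st_def by (rule alg_value_grun[OF M]) (simp add: completion_def)
  have "0 < card (gall st)" using G.fin G.root(1) by (auto simp: card_gt_0_iff)
  then have "real (opt_value I) \<le> \<rho> * real (card (gall st))"
    using ratio by (simp add: alg field_simps)
  moreover have "0 \<le> \<rho>" using ratio order_trans[OF _ ratio] by simp
  then have "\<rho> * real (card (gall st)) \<le>
      \<rho> * (1 + real m * real s + (real m + 1) * \<Omega> + (real m - 1) * (\<eta> + \<epsilon>) - q * \<eta>)"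
    using G.card_all_le[OF k big \<Omega> \<eta> \<epsilon> cond] unfolding q_def by (intro mult_left_mono)
  moreover have "(real m - 1 - q) * real B + (real m + 1 + q) * (real B - real s - real \<sigma>)
      \<le> real (opt_value I)"
    using G.opt_completion_ge(2)[OF k big B_large] by (simp add: I_def q_def)
  moreover have "0 \<le> q" "q \<le> real m - 1"
    using G.opt_completion_ge(1)[OF k big B_large] by (simp_all add: q_def)
  ultimately show ?thesis by (intro exI[of _ q]) linarith
qed

text \<open>All lengths are divided by the budget here.\<close>
lemma normalized_bound:
  fixes \<rho> \<rho>\<^sub>0 m q s \<sigma> u \<Omega> \<eta> \<epsilon> :: real
  assumes bound: "(m - 1 - q) + (m + 1 + q) * (1 - s - \<sigma>) \<le>
      \<rho> * (u + m * s + (m + 1) * \<Omega> + (m - 1) * (\<eta> + \<epsilon>) - q * \<eta>)"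
    and q: "0 \<le> q" "q \<le> m - 1" and \<rho>: "\<rho> \<le> \<rho>\<^sub>0"
    and nonneg: "0 \<le> u" "0 \<le> \<Omega>" "0 \<le> \<eta>" "0 \<le> \<epsilon>"
  shows "(\<rho>\<^sub>0 - \<rho>) * (m * s) \<le> \<rho>\<^sub>0 * (u + m * s + (m + 1) * \<Omega> + (m - 1) * (\<eta> + \<epsilon>))
      - 2 * m + (m + 1) * (s + \<sigma>) + m * \<bar>s + \<sigma> - \<rho>\<^sub>0 * \<eta>\<bar>"
proof -
  define U where "U = u + m * s + (m + 1) * \<Omega> + (m - 1) * (\<eta> + \<epsilon>) - q * \<eta>"
  have "0 \<le> (m + 1) * \<Omega>" "0 \<le> (m - 1) * \<epsilon>" "0 \<le> (m - 1 - q) * \<eta>"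
    using q nonneg by simp_all
  \<comment> \<open>The algorithm's bound is at least \<open>m * s\<close>, so a ratio below
    \<open>\<rho>\<^sub>0\<close> gains an amount proportional to \<open>m\<close>.\<close>
  then have "m * s \<le> U" using nonneg by (simp add: U_def algebra_simps)
  then have "(\<rho>\<^sub>0 - \<rho>) * (m * s) \<le> (\<rho>\<^sub>0 - \<rho>) * U" using \<rho> by (intro mult_left_mono) simp_all
  \<comment> \<open>The net effect of the dead legs; the absolute value tends to \<open>0\<close>
    for the balanced choice of \<open>s\<close>.\<close>
  moreover have "q * (s + \<sigma> - \<rho>\<^sub>0 * \<eta>) \<le> m * \<bar>s + \<sigma> - \<rho>\<^sub>0 * \<eta>\<bar>"
    by (rule order_trans[OF mult_left_mono[OF abs_ge_self] mult_right_mono]) (use q in simp_all)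
  moreover have "\<rho>\<^sub>0 * (u + m * s + (m + 1) * \<Omega> + (m - 1) * (\<eta> + \<epsilon>)) = \<rho>\<^sub>0 * U + \<rho>\<^sub>0 * (q * \<eta>)"
    by (simp add: U_def algebra_simps)
  ultimately show ?thesis using bound unfolding U_def[symmetric] by (simp add: algebra_simps)
qed

text \<open>Here \<open>m\<close> is fixed and the budget tends to infinity. In the limit all terms
  of order \<open>m\<close> on the right cancel, and a constant remains.\<close>

lemma competitive_limit:
  fixes \<rho> :: real and m :: nat
  defines "s\<^sub>0 \<equiv> (19 - 3 * sqrt 17) / 26" and "\<rho>\<^sub>0 \<equiv> (5 + 3 * sqrt 17) / 8"
  assumes comp: "competitive \<rho> A" and m: "1 \<le> m" and \<rho>: "\<rho> < \<rho>\<^sub>0"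
  shows "(\<rho>\<^sub>0 - \<rho>) * (real m * s\<^sub>0) \<le> \<rho>\<^sub>0 + s\<^sub>0"
proof -
  have "(412 / 100)\<^sup>2 < (17 :: real)" "(17 :: real) < (413 / 100)\<^sup>2" by (simp_all add: power2_eq_square)
  then have "sqrt ((412 / 100)\<^sup>2) < sqrt 17" "sqrt 17 < sqrt ((413 / 100)\<^sup>2)"
    by (simp_all only: real_sqrt_less_iff)
  then have "412 / 100 < sqrt 17" "sqrt 17 < 413 / 100" by simp_all
  then have s0: "254 / 1000 < s\<^sub>0" "s\<^sub>0 < 256 / 1000" and \<rho>0: "0 < \<rho>\<^sub>0"
    by (simp_all add: s\<^sub>0_def \<rho>\<^sub>0_def)
  \<comment> \<open>\<open>N n * \<sigma> n\<close> equals
    \<open>2 * m * B n + 2 * \<sigma> n\<close> and so exceeds \<open>k * B n + 1\<close> for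
    \<open>k = 2 * m\<close>, while \<open>\<sigma> n\<close> and the square of \<open>N n\<close>
    are of smaller order than \<open>B n\<close>. \<open>T n\<close> is the least number with
    \<open>B n \<le> 2 * T n + s n\<close>.\<close>
  define B \<sigma> N s T :: "nat \<Rightarrow> nat" where "B n = n ^ 4" and "\<sigma> n = n ^ 3" and "N n = 2 * m * n + 2"
    and "s n = nat \<lfloor>s\<^sub>0 * real (B n)\<rfloor>" and "T n = (B n - s n + 1) div 2" for n
  define s' T' \<sigma>' u' \<epsilon>' where "s' n = real (s n) / real (B n)" and "T' n = real (T n) / real (B n)"
    and "\<sigma>' n = real (\<sigma> n) / real (B n)" and "u' n = 1 / real (B n)"
    and "\<epsilon>' n = (real (N n) + real (N n) * real (N n) + real (\<sigma> n)) / real (B n)" for n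
  define \<eta>' \<Omega>' where "\<eta>' n = (1 - 3 * s' n) / 2" and "\<Omega>' n = (1 + T' n + \<sigma>' n) / 2 - s' n" for n
  define \<eta>\<^sub>0 \<Omega>\<^sub>0 where "\<eta>\<^sub>0 = (1 - 3 * s\<^sub>0) / 2" and "\<Omega>\<^sub>0 = (1 + (1 - s\<^sub>0) / 2 + 0) / 2 - s\<^sub>0"
  \<comment> \<open>The first equation makes dead legs irrelevant for the ratio.\<close>
  have bal: "s\<^sub>0 = \<rho>\<^sub>0 * \<eta>\<^sub>0" "2 - s\<^sub>0 = \<rho>\<^sub>0 * (s\<^sub>0 + \<Omega>\<^sub>0 + \<eta>\<^sub>0)"
    by (simp_all add: s\<^sub>0_def \<rho>\<^sub>0_def \<eta>\<^sub>0_def \<Omega>\<^sub>0_def field_simps)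
  have Bpos: "0 < real (B n)" if "1 \<le> n" for n using that by (simp add: B_def)
  have s_le: "real (s n) \<le> s\<^sub>0 * real (B n)" "s\<^sub>0 * real (B n) - 1 \<le> real (s n)" for n
  proof -
    have "0 \<le> s\<^sub>0 * real (B n)" using s0 by simp
    then have "real (s n) = of_int \<lfloor>s\<^sub>0 * real (B n)\<rfloor>" by (simp add: s_def)
    then show "real (s n) \<le> s\<^sub>0 * real (B n)" "s\<^sub>0 * real (B n) - 1 \<le> real (s n)" by linarith+
  qed
  have sB: "s n \<le> B n" for n
  proof -
    have "s\<^sub>0 * real (B n) \<le> 1 * real (B n)" using s0 by (intro mult_right_mono) simp_all
    then show ?thesis using s_le(1)[of n] by linarith
  qed
  have T_bounds: "B n \<le> 2 * T n + s n" "2 * T n + s n \<le> B n + 1" for n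
    using sB[of n] by (simp_all add: T_def)
  have u: "u' \<longlonglongrightarrow> 0" unfolding u'_def B_def by real_asymp
  have \<sigma>: "\<sigma>' \<longlonglongrightarrow> 0" unfolding \<sigma>'_def \<sigma>_def B_def by real_asymp
  have \<epsilon>: "\<epsilon>' \<longlonglongrightarrow> 0" unfolding \<epsilon>'_def \<sigma>_def B_def N_def by real_asymp
  have unscale: "s' n * B n = s n" "T' n * B n = T n" "u' n * B n = 1" if "1 \<le> n" for n
    using Bpos[OF that] by (simp_all add: s'_def T'_def u'_def)
  have cancel: "eventually (\<lambda>n. f n \<le> g n) sequentially"
    if "\<And>n. 1 \<le> n \<Longrightarrow> f n * real (B n) \<le> g n * real (B n)" for f g
    using eventually_ge_at_top[of 1]
    by (rule eventually_mono) (rule mult_right_le_imp_le[OF that Bpos])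
  have s: "s' \<longlonglongrightarrow> s\<^sub>0"
  proof (rule tendsto_sandwich)
    show "(\<lambda>n. s\<^sub>0 - u' n) \<longlonglongrightarrow> s\<^sub>0" using tendsto_diff[OF tendsto_const u] by simp
    show "eventually (\<lambda>n. s\<^sub>0 - u' n \<le> s' n) sequentially"
      using s_le(2) by (intro cancel) (simp add: left_diff_distrib unscale)
    show "eventually (\<lambda>n. s' n \<le> s\<^sub>0) sequentially"
      using s_le(1) by (intro cancel) (simp add: unscale)
  qed simp
  have T: "T' \<longlonglongrightarrow> (1 - s\<^sub>0) / 2"
  proof (rule tendsto_sandwich)
    have half: "(1 - s' n) / 2 * B n = (real (B n) - real (s n)) / 2" if "1 \<le> n" for n
      using unscale(1)[OF that] by (simp add: left_diff_distrib)
    show "(\<lambda>n. (1 - s' n) / 2) \<longlonglongrightarrow> (1 - s\<^sub>0) / 2" by (intro tendsto_intros s) simp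
    have "(\<lambda>n. (1 - s' n) / 2 + u' n) \<longlonglongrightarrow> (1 - s\<^sub>0) / 2 + 0" by (intro tendsto_intros s u) simp
    then show "(\<lambda>n. (1 - s' n) / 2 + u' n) \<longlonglongrightarrow> (1 - s\<^sub>0) / 2" by simp
    show "eventually (\<lambda>n. (1 - s' n) / 2 \<le> T' n) sequentially"
    proof (rule cancel)
      fix n :: nat assume n: "1 \<le> n"
      have "real (B n) \<le> 2 * real (T n) + real (s n)" using T_bounds(1)[of n] by linarith
      then show "(1 - s' n) / 2 * B n \<le> T' n * B n" unfolding half[OF n] unscale[OF n] by simp
    qed
    show "eventually (\<lambda>n. T' n \<le> (1 - s' n) / 2 + u' n) sequentially"
    proof (rule cancel)
      fix n :: nat assume n: "1 \<le> n"
      have "2 * real (T n) + real (s n) \<le> real (B n) + 1" using T_bounds(2)[of n] by linarith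
      then show "T' n * B n \<le> ((1 - s' n) / 2 + u' n) * B n"
        unfolding distrib_right half[OF n] unscale[OF n] by argo
    qed
  qed
  have \<eta>: "\<eta>' \<longlonglongrightarrow> \<eta>\<^sub>0" unfolding \<eta>'_def \<eta>\<^sub>0_def by (intro tendsto_intros s) simp
  have \<Omega>: "\<Omega>' \<longlonglongrightarrow> \<Omega>\<^sub>0" unfolding \<Omega>'_def \<Omega>\<^sub>0_def by (intro tendsto_intros s T \<sigma>) simp
  have pos: "eventually (\<lambda>n. 0 < f n) sequentially" if "f \<longlonglongrightarrow> l" "0 < l" for f :: "nat \<Rightarrow> real" and l
    using order_tendstoD(1)[OF that] .
  \<comment> \<open>The conditions of \<open>competitive_bound\<close> hold strictly for the limits,
    \<open>s\<^sub>0\<close> being about 0.255, and hence eventually.\<close>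
  have e: "eventually (\<lambda>n. 0 < s' n) sequentially"
    "eventually (\<lambda>n. 0 < T' n - (s' n + \<sigma>' n)) sequentially"
    "eventually (\<lambda>n. 0 < 1 - (T' n + \<sigma>' n + u' n)) sequentially"
    "eventually (\<lambda>n. 0 < \<eta>' n) sequentially"
    "eventually (\<lambda>n. 0 < s' n - \<eta>' n) sequentially"
    "eventually (\<lambda>n. 0 < \<Omega>' n - 2 * \<eta>' n) sequentially"
    "eventually (\<lambda>n. 0 < \<Omega>' n - (\<eta>' n + \<epsilon>' n)) sequentially"
    "eventually (\<lambda>n. 0 < \<Omega>' n) sequentially"
    by (rule pos[OF s] pos[OF tendsto_diff[OF T tendsto_add[OF s \<sigma>]]]
        pos[OF tendsto_diff[OF tendsto_const tendsto_add[OF tendsto_add[OF T \<sigma>] u]]]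
        pos[OF \<eta>] pos[OF tendsto_diff[OF s \<eta>]]
        pos[OF tendsto_diff[OF \<Omega> tendsto_mult[OF tendsto_const \<eta>]]]
        pos[OF tendsto_diff[OF \<Omega> tendsto_add[OF \<eta> \<epsilon>]]] pos[OF \<Omega>],
        use s0 in \<open>simp add: \<Omega>\<^sub>0_def \<eta>\<^sub>0_def field_simps\<close>)+
  have "eventually (\<lambda>n. (\<rho>\<^sub>0 - \<rho>) * (real m * s' n) \<le>
      \<rho>\<^sub>0 * (u' n + real m * s' n + (real m + 1) * \<Omega>' n + (real m - 1) * (\<eta>' n + \<epsilon>' n))
      - 2 * real m + (real m + 1) * (s' n + \<sigma>' n) + real m * \<bar>s' n + \<sigma>' n - \<rho>\<^sub>0 * \<eta>' n\<bar>) sequentially"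
    using e eventually_ge_at_top[of 1]
  proof eventually_elim
    case (elim n)
    note B = Bpos[OF \<open>1 \<le> n\<close>]
    have eqs: "real (s n) = s' n * B n" "real (T n) = T' n * B n" "real (\<sigma> n) = \<sigma>' n * B n"
      "real (N n) + real (N n) * real (N n) + real (\<sigma> n) = \<epsilon>' n * B n"
      using B by (simp_all add: s'_def T'_def \<sigma>'_def \<epsilon>'_def)
    have u1: "u' n * B n = 1" using B by (simp add: u'_def)
    have scale: "x * B n \<le> y * B n" if "0 < y - x" for x y :: real
      using that B by (intro mult_right_mono) simp_all
    have scale': "x * B n < y * B n" if "0 < y - x" for x y :: real
      using that B by (intro mult_strict_right_mono) simp_all
    have s_pos: "1 \<le> s n" using elim(1) B by (simp add: s'_def zero_less_divide_iff)
    have \<sigma>_pos: "1 \<le> \<sigma> n" using \<open>1 \<le> n\<close> by (simp add: \<sigma>_def)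
    have T_large: "s n + \<sigma> n < T n"
      using scale'[OF elim(2)] by (simp add: distrib_right eqs[symmetric] flip: of_nat_add)
    have B_large: "T n + \<sigma> n + 1 < B n"
      using scale'[OF elim(3)] by (simp add: distrib_right eqs[symmetric] u1)
    interpret adversary m "2 * m" "s n" "T n" "\<sigma> n" "N n" "B n"
      by unfold_locales (use m s_pos \<sigma>_pos T_large T_bounds(1)[of n] in \<open>simp_all add: N_def\<close>)
    have "N n * \<sigma> n = 2 * m * B n + 2 * \<sigma> n"
      by (simp add: N_def \<sigma>_def B_def algebra_simps power4_eq_xxxx power3_eq_cube)
    then have big: "2 * m * B n + 1 < N n * \<sigma> n" using \<sigma>_pos by simp
    have \<Omega>_eq: "\<Omega>' n * B n = (real (B n) + real (T n) + real (\<sigma> n)) / 2 - real (s n)"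
      and \<eta>_eq: "\<eta>' n * B n = (real (B n) - 3 * real (s n)) / 2"
      unfolding eqs by (simp_all add: \<Omega>'_def \<eta>'_def field_simps)
    have "0 \<le> \<eta>' n * B n" "\<eta>' n * B n \<le> real (s n)" "2 * (\<eta>' n * B n) \<le> \<Omega>' n * B n"
      "\<eta>' n * B n + \<epsilon>' n * B n \<le> \<Omega>' n * B n" "0 < \<Omega>' n * B n"
      using elim B scale[OF elim(5)] scale[OF elim(6)] scale[OF elim(7)]
      by (simp_all add: eqs distrib_right)
    from competitive_bound[OF comp refl big B_large \<Omega>_eq \<eta>_eq eqs(4)[symmetric] this]
    obtain q where q: "0 \<le> q" "q \<le> real m - 1" and
      bound: "(real m - 1 - q) * real (B n) + (real m + 1 + q) * (real (B n) - real (s n) - real (\<sigma> n))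
        \<le> \<rho> * (1 + real m * real (s n) + (real m + 1) * (\<Omega>' n * B n) +
            (real m - 1) * (\<eta>' n * B n + \<epsilon>' n * B n) - q * (\<eta>' n * B n))"
      by blast
    define Z where "Z = real m * s' n + (real m + 1) * \<Omega>' n + (real m - 1) * (\<eta>' n + \<epsilon>' n) - q * \<eta>' n"
    have "1 + real m * real (s n) + (real m + 1) * (\<Omega>' n * B n) +
        (real m - 1) * (\<eta>' n * B n + \<epsilon>' n * B n) - q * (\<eta>' n * B n) = 1 + Z * B n"
      unfolding eqs by (simp add: Z_def algebra_simps)
    also have "\<dots> = (u' n + Z) * B n" by (simp add: distrib_right u1)
    finally have "((real m - 1 - q) + (real m + 1 + q) * (1 - s' n - \<sigma>' n)) * B n \<le> \<rho> * (u' n + Z) * B n"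
      using bound unfolding eqs by (simp add: algebra_simps)
    then have "(real m - 1 - q) + (real m + 1 + q) * (1 - s' n - \<sigma>' n) \<le> \<rho> * (u' n + Z)"
      using B by (simp only: mult_le_cancel_right_pos)
    moreover have "u' n + Z = u' n + real m * s' n + (real m + 1) * \<Omega>' n +
        (real m - 1) * (\<eta>' n + \<epsilon>' n) - q * \<eta>' n" by (simp add: Z_def)
    ultimately have "(real m - 1 - q) + (real m + 1 + q) * (1 - s' n - \<sigma>' n) \<le>
        \<rho> * (u' n + real m * s' n + (real m + 1) * \<Omega>' n + (real m - 1) * (\<eta>' n + \<epsilon>' n) - q * \<eta>' n)"
      by simp
    then show ?case
      by (rule normalized_bound) (use q \<rho> elim in \<open>simp_all add: u'_def \<epsilon>'_def\<close>)
  qed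
  then have "(\<rho>\<^sub>0 - \<rho>) * (real m * s\<^sub>0) \<le>
      \<rho>\<^sub>0 * (0 + real m * s\<^sub>0 + (real m + 1) * \<Omega>\<^sub>0 + (real m - 1) * (\<eta>\<^sub>0 + 0))
      - 2 * real m + (real m + 1) * (s\<^sub>0 + 0) + real m * \<bar>s\<^sub>0 + 0 - \<rho>\<^sub>0 * \<eta>\<^sub>0\<bar>"
    by (rule tendsto_le[rotated 3]) (simp, (intro tendsto_intros s u \<sigma> \<epsilon> \<eta> \<Omega>)+)
  \<comment> \<open>The first balance equation removes the absolute value; the second one makes the
    factor of \<open>real m\<close> vanish.\<close>
  also have "\<dots> = real m * (\<rho>\<^sub>0 * (s\<^sub>0 + \<Omega>\<^sub>0 + \<eta>\<^sub>0) - (2 - s\<^sub>0)) + \<rho>\<^sub>0 * (\<Omega>\<^sub>0 - \<eta>\<^sub>0) + s\<^sub>0"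
    using bal(1) by (simp add: algebra_simps)
  also have "\<dots> = \<rho>\<^sub>0 * (\<Omega>\<^sub>0 - \<eta>\<^sub>0) + s\<^sub>0" using bal(2) by simp
  also have "\<rho>\<^sub>0 * (\<Omega>\<^sub>0 - \<eta>\<^sub>0) \<le> \<rho>\<^sub>0 * 1"
    using s0 \<rho>0 by (intro mult_left_mono) (simp_all add: \<Omega>\<^sub>0_def \<eta>\<^sub>0_def field_simps)
  finally show ?thesis by simp
qed

theorem theorem2:
  shows "\<not> (\<exists>\<rho> A. \<rho> < (5 + 3 * sqrt 17) / 8 \<and> competitive \<rho> A)"
proof
  assume "\<exists>\<rho> A. \<rho> < (5 + 3 * sqrt 17) / 8 \<and> competitive \<rho> A"
  then obtain \<rho> A where \<rho>: "\<rho> < (5 + 3 * sqrt 17) / 8" and comp: "competitive \<rho> A" by blast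
  define s\<^sub>0 where "s\<^sub>0 = (19 - 3 * sqrt 17) / 26"
  define c where "c = ((5 + 3 * sqrt 17) / 8 - \<rho>) * s\<^sub>0"
  have "sqrt 17 < 19 / 3" by (rule real_less_lsqrt) (simp_all add: power2_eq_square)
  then have "0 < c" using \<rho> by (simp add: c_def s\<^sub>0_def)
  \<comment> \<open>The left side of \<open>competitive_limit\<close> is linear in \<open>m\<close>
    with slope \<open>c > 0\<close>, and the right side does not depend on \<open>m\<close>.\<close>
  then obtain m :: nat where m: "(5 + 3 * sqrt 17) / 8 + s\<^sub>0 < real m * c"
    using reals_Archimedean3 by blast
  moreover have "1 \<le> Suc m" by simp
  note competitive_limit[OF comp this \<rho>]
  moreover have "real m * c \<le> real (Suc m) * c" using \<open>0 < c\<close> by (intro mult_right_mono) simp_all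
  ultimately show False by (simp add: c_def s\<^sub>0_def mult.commute mult.left_commute)
qed

end
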